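(* Let $\lambda$ be a partition and let $\mathbf{b}=(b_1\le b_2\le\cdots\le b_{\ell(\lambda)})$ be a flag of integers. Then $$s_{\lambda,\mathbf{b}}=\sum_{T\in\mathrm{SYT}(\lambda)}\mathfrak{F}_{(\mathcal{L}_T,\rho_{\mathbf{b}})}=\sum_{T\in\mathrm{SYT}(\lambda)}\mathfrak{F}_{\mathrm{red}(\mathcal{L}_T,\rho_{\mathbf{b}})},$$ where $\mathcal{L}_T$ is the linear extension of $\mathcal{P}_\lambda$ determined by the standard tableau $T$, and where a term $\mathfrak{F}_{\mathrm{red}(\mathcal{L}_T,\rho_{\mathbf{b}})}$ is interpreted as $0$ if $\overline{\rho_{\mathbf{b}}}^{\mathcal{L}_T}(i)\le0$ for some $i$.
   Context: For a partition $\lambda=(\lambda_1\ge\cdots\ge\lambda_\ell>0)$ with $\ell=\ell(\lambda)$ and $p=\sum\lambda_r$, the cells are pairs $(r,c)$ with $1\le r\le\ell$, $1\le c\le\lambda_r$. A semistandard tableau of shape $\lambda$ fills the cells with positive integers, weakly increasing in $c$ along each row and strictly increasing in $r$ along each column; a standard tableau uses each of $1,\dots,p$ exactly once, and $\mathrm{SYT}(\lambda)$ is the set of standard tableaux. The flagged Schur function $s_{\lambda,\mathbf{b}}$ is the sum of the monomials $\prod_{(r,c)}x_{S(r,c)}$ over semistandard tableaux $S$ of shape $\lambda$ with all entries in row $r$ at most $b_r$ for every $r$. $\mathcal{P}_\lambda$ is the poset on $[p]=\{1,\dots,p\}$ obtained by labelling the cell $(r,c)$ by $\lambda_{r+1}+\cdots+\lambda_\ell+c$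 (rows are labelled consecutively left to right, beginning with row $\ell$ and ending with row $1$), with order $(r,c)\preceq(r',c')$ iff $r\le r'$ and $c\le c'$. $\rho_{\mathbf{b}}(x)=b_r$ if the cell labelled $x$ is in row $r$. For $T\in\mathrm{SYT}(\lambda)$, $\mathcal{L}_T$ is the linear order on $[p]$ in which the labels of cells appear in increasing order of the entries of $T$; it is a linear extension of $\mathcal{P}_\lambda$. For a poset $\mathcal{P}$ on $[p]$ with order $\prec$, $i\prec\!\cdot\, j$ means $j$ covers $i$; $<$ is the natural order on integers; $\mathbb{N}=\{1,2,3,\dots\}$. Given $\rho:[p]\to\mathbb{Z}$, a $(\mathcal{P},\rho)$-partition is a function $f:[p]\to\mathbb{N}$ such that (1) if $i\prec j$ then $f(i)\le f(j)$; (2) if $i\prec j$ and $i>j$ then $f(i)<f(j)$; (3) $f(i)\le\rho(i)$ for all $i$. Let $\mathscr{A}_\rho(\mathcal{P})$ be the set of these and $\mathfrak{F}_{(\mathcal{P},\rho)}=\sum_{f\in\mathscr{A}_\rho(\mathcal{P})}x_{f(1)}\cdots x_{f(p)}$. For $i\preceq j$ in $\mathcal{P}$ let $\delta(i,j)$ be the maximum, over all chains $i=i_0\prec i_1\prec\cdots\prec i_k=j$ in $\mathcal{P}$, of the number of indices $t$ with $i_{t-1}>i_t$. Define $\overline{\rho}^{\mathcal{P}}(i)=\min\{\rho(x)-\delta(i,x)\mid i\preceq x\}$. For a linear order $\mathcal{L}$ on $[p]$ and $\rho$ with $\overline{\rho}^{\mathcal{L}}\ge1$ everywhere, $\mathrm{red}(\mathcal{L},\rho)$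 is the weak composition defined as follows: in the Hasse diagram of $\mathcal{L}$ remove every edge $i\prec\!\cdot\, j$ with $i>j$; let $C_1,\dots,C_r$ be the resulting chains in ascending order of $\mathcal{L}$, and let $c_s=\overline{\rho}^{\mathcal{L}}(\min_{\mathcal{L}}C_s)$; the $c_s$-th part is $|C_s|$ for $s=1,\dots,r$ and all other parts are $0$. A weak composition is a finite sequence of nonnegative integers; a strong composition is a finite sequence of positive integers. $\mathrm{flat}(a)$ is obtained from $a$ by removing zeros. A strong composition $\beta$ refines $\alpha$ if they have the same total sum and every partial sum $\alpha_1+\cdots+\alpha_j$ equals some partial sum of $\beta$. $b\trianglerighteq a$ means $b_1+\cdots+b_k\ge a_1+\cdots+a_k$ for all $k$. For a weak composition $a$ of length $n$, the slide polynomial is $\mathfrak{F}_a=\sum_b x_1^{b_1}\cdots x_n^{b_n}$, the sum over weak compositions $b$ of length $n$ with $b\trianglerighteq a$ and $\mathrm{flat}(b)$ refining $\mathrm{flat}(a)$. (Appending trailing zeros to $a$ does not change $\mathfrak{F}_a$.) *)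

theory Defs
  imports "HOL-Library.Poly_Mapping" "HOL-Library.FuncSet"
begin

section \<open>Polynomials\<close>

text \<open>
  Polynomials over the integers in variables \<open>x\<^sub>i\<close>, \<open>i :: nat\<close>: finitely supported
  functions from exponent vectors to coefficients, multiplied by convolution.
  Only the variables with \<open>i \<ge> 1\<close> occur below.
\<close>

type_synonym int_mpoly = "(nat \<Rightarrow>\<^sub>0 nat) \<Rightarrow>\<^sub>0 int"

definition X :: "nat \<Rightarrow> int_mpoly" where
  "X i = Poly_Mapping.single (Poly_Mapping.single i 1) 1"


section \<open>Partitions, tableaux and flagged Schur functions\<close>

text \<open>
  Rows and columns are numbered from 1, so the part \<open>\<lambda>\<^sub>r\<close> is \<open>lam ! (r - 1)\<close>
  and the flag entry \<open>b\<^sub>r\<close> is \<open>b ! (r - 1)\<close>.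
\<close>

definition is_partition :: "nat list \<Rightarrow> bool" where
  "is_partition lam \<longleftrightarrow> sorted_wrt (\<ge>) lam \<and> (\<forall>x\<in>set lam. 0 < x)"

definition cells :: "nat list \<Rightarrow> (nat \<times> nat) set" where
  "cells lam = {(r, c). 1 \<le> r \<and> r \<le> length lam \<and> 1 \<le> c \<and> c \<le> lam ! (r - 1)}"

text \<open>
  Fillings are extensional functions (\<open>undefined\<close> off the shape), so that distinct
  members of the sets below are distinct fillings; likewise for \<open>P_partitions\<close>.
\<close>

definition SSYT :: "nat list \<Rightarrow> (nat \<times> nat \<Rightarrow> nat) set" where
  "SSYT lam = {S \<in> cells lam \<rightarrow>\<^sub>E {1..}.
     (\<forall>r c c'. (r, c) \<in> cells lam \<and> (r, c') \<in> cells lam \<and> c < c' \<longrightarrow> S (r, c) \<le> S (r, c')) \<and>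
     (\<forall>r r' c. (r, c) \<in> cells lam \<and> (r', c) \<in> cells lam \<and> r < r' \<longrightarrow> S (r, c) < S (r', c))}"

definition SYT :: "nat list \<Rightarrow> (nat \<times> nat \<Rightarrow> nat) set" where
  "SYT lam = {T \<in> SSYT lam. bij_betw T (cells lam) {1..sum_list lam}}"

definition flagged_schur :: "nat list \<Rightarrow> int list \<Rightarrow> int_mpoly" where
  "flagged_schur lam b =
     (\<Sum>S | S \<in> SSYT lam \<and> (\<forall>(r, c)\<in>cells lam. int (S (r, c)) \<le> b ! (r - 1)).
        \<Prod>u\<in>cells lam. X (S u))"


section \<open>Posets on \<open>{1..p}\<close> and \<open>(P, \<rho>)\<close>-partitions\<close>

text \<open>
  A poset on \<open>{1..p}\<close> is a reflexive relation \<open>P\<close> with \<open>partial_order_on {1..p} P\<close>;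
  \<open>(i, j) \<in> P\<close> means \<open>i \<preceq> j\<close>.
\<close>

definition strict_less :: "nat rel \<Rightarrow> nat \<Rightarrow> nat \<Rightarrow> bool" where
  "strict_less P i j \<longleftrightarrow> (i, j) \<in> P \<and> i \<noteq> j"

definition covers :: "nat rel \<Rightarrow> nat \<Rightarrow> nat \<Rightarrow> bool" where
  "covers P i j \<longleftrightarrow> strict_less P i j \<and> \<not> (\<exists>k. strict_less P i k \<and> strict_less P k j)"

definition linear_extension :: "nat \<Rightarrow> nat rel \<Rightarrow> nat rel \<Rightarrow> bool" where
  "linear_extension p P L \<longleftrightarrow> linear_order_on {1..p} L \<and> P \<subseteq> L"

definition P_partitions :: "nat \<Rightarrow> nat rel \<Rightarrow> (nat \<Rightarrow> int) \<Rightarrow> (nat \<Rightarrow> nat) set" where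
  "P_partitions p P \<rho> = {f \<in> {1..p} \<rightarrow>\<^sub>E {1..}.
     (\<forall>i j. strict_less P i j \<longrightarrow> f i \<le> f j) \<and>
     (\<forall>i j. strict_less P i j \<and> i > j \<longrightarrow> f i < f j) \<and>
     (\<forall>i\<in>{1..p}. int (f i) \<le> \<rho> i)}"

definition P_partition_gf :: "nat \<Rightarrow> nat rel \<Rightarrow> (nat \<Rightarrow> int) \<Rightarrow> int_mpoly" where
  "P_partition_gf p P \<rho> = (\<Sum>f\<in>P_partitions p P \<rho>. \<Prod>i=1..p. X (f i))"

definition poset_chains :: "nat rel \<Rightarrow> nat \<Rightarrow> nat \<Rightarrow> nat list set" where
  "poset_chains P i j =
     {xs. xs \<noteq> [] \<and> hd xs = i \<and> last xs = j \<and> successively (strict_less P) xs}"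

definition num_descents :: "nat list \<Rightarrow> nat" where
  "num_descents xs = card {t. Suc t < length xs \<and> xs ! t > xs ! Suc t}"

definition max_descents :: "nat rel \<Rightarrow> nat \<Rightarrow> nat \<Rightarrow> nat" where
  "max_descents P i j = Max (num_descents ` poset_chains P i j)"

definition rho_bar :: "nat rel \<Rightarrow> (nat \<Rightarrow> int) \<Rightarrow> nat \<Rightarrow> int" where
  "rho_bar P \<rho> i = Min {\<rho> x - int (max_descents P i x) | x. (i, x) \<in> P}"


section \<open>The poset of a partition and the linear order of a standard tableau\<close>

definition label :: "nat list \<Rightarrow> nat \<times> nat \<Rightarrow> nat" where
  "label lam u = sum_list (drop (fst u) lam) + snd u"

definition cell_of :: "nat list \<Rightarrow> nat \<Rightarrow> nat \<times> nat" where
  "cell_of lam = inv_into (cells lam) (label lam)"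

definition shape_poset :: "nat list \<Rightarrow> nat rel" where
  "shape_poset lam = {(label lam (r, c), label lam (r', c')) | r c r' c'.
     (r, c) \<in> cells lam \<and> (r', c') \<in> cells lam \<and> r \<le> r' \<and> c \<le> c'}"

definition flag_rho :: "nat list \<Rightarrow> int list \<Rightarrow> nat \<Rightarrow> int" where
  "flag_rho lam b x = b ! (fst (cell_of lam x) - 1)"

definition tableau_order :: "nat list \<Rightarrow> (nat \<times> nat \<Rightarrow> nat) \<Rightarrow> nat rel" where
  "tableau_order lam T =
     {(label lam u, label lam v) | u v. u \<in> cells lam \<and> v \<in> cells lam \<and> T u \<le> T v}"

lemma cells_Cons:
  "cells (x # xs) = Pair 1 ` {1..x} \<union> (\<lambda>(r, c). (Suc r, c)) ` cells xs"
proof (intro equalityI subsetI)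
  fix u assume u: "u \<in> cells (x # xs)"
  obtain r c where [simp]: "u = (r, c)" by (cases u)
  have rc: "1 \<le> r" "r \<le> Suc (length xs)" "1 \<le> c" "c \<le> (x # xs) ! (r - 1)"
    using u by (auto simp: cells_def)
  show "u \<in> Pair 1 ` {1..x} \<union> (\<lambda>(r, c). (Suc r, c)) ` cells xs"
  proof (cases "r = 1")
    case True
    then show ?thesis using rc by auto
  next
    case False
    define q where "q = r - 2"
    have q: "r = Suc (Suc q)" using rc(1) False by (simp add: q_def)
    then have "(Suc q, c) \<in> cells xs" using rc by (simp add: cells_def)
    then have "(\<lambda>(r, c). (Suc r, c)) (Suc q, c) \<in> (\<lambda>(r, c). (Suc r, c)) ` cells xs"
      by (rule imageI)
    then show ?thesis using q by simp
  qed
next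
  fix u assume "u \<in> Pair 1 ` {1..x} \<union> (\<lambda>(r, c). (Suc r, c)) ` cells xs"
  then show "u \<in> cells (x # xs)"
  proof
    assume "u \<in> Pair 1 ` {1..x}"
    then show ?thesis by (auto simp: cells_def)
  next
    assume "u \<in> (\<lambda>(r, c). (Suc r, c)) ` cells xs"
    then obtain r c where "u = (Suc r, c)" "(r, c) \<in> cells xs" by auto
    then show ?thesis by (cases r) (auto simp: cells_def)
  qed
qed

lemma bij_betw_label: "bij_betw (label lam) (cells lam) {1..sum_list lam}"
proof (induction lam)
  case Nil
  have "cells [] = {}" by (auto simp: cells_def)
  then show ?case by (simp add: bij_betw_def)
next
  case (Cons x xs)
  have 1: "bij_betw (label (x # xs)) (Pair 1 ` {1..x}) {Suc (sum_list xs)..sum_list xs + x}"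
  proof (rule bij_betw_byWitness[where f' = "\<lambda>k. (1, k - sum_list xs)"])
    show "(\<lambda>k. (1, k - sum_list xs)) ` {Suc (sum_list xs)..sum_list xs + x} \<subseteq> Pair 1 ` {1..x}"
    proof
      fix u assume "u \<in> (\<lambda>k. (1, k - sum_list xs)) ` {Suc (sum_list xs)..sum_list xs + x}"
      then obtain k where "u = (1, k - sum_list xs)" "k - sum_list xs \<in> {1..x}" by force
      then show "u \<in> Pair 1 ` {1..x}" by (rule image_eqI)
    qed
  qed (auto simp: label_def)
  have inj: "inj_on (\<lambda>(r, c). (Suc r, c)) (cells xs)"
    by (auto simp: inj_on_def)
  have eq: "label (x # xs) \<circ> (\<lambda>(r, c). (Suc r, c)) = label xs"
    by (rule ext) (simp add: label_def split: prod.split)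
  have "bij_betw (\<lambda>(r, c). (Suc r, c)) (cells xs) ((\<lambda>(r, c). (Suc r, c)) ` cells xs)"
    using inj by (rule inj_on_imp_bij_betw)
  then have 2: "bij_betw (label (x # xs)) ((\<lambda>(r, c). (Suc r, c)) ` cells xs) {1..sum_list xs}"
    using Cons.IH by (simp only: bij_betw_comp_iff[of _ _ _ "label (x # xs)"] eq)
  have "{1..sum_list (x # xs)} = {Suc (sum_list xs)..sum_list xs + x} \<union> {1..sum_list xs}"
    by auto
  then show ?case
    unfolding cells_Cons using bij_betw_combine[OF 1 2] by simp
qed

lemma cell_of_label [simp]: "u \<in> cells lam \<Longrightarrow> cell_of lam (label lam u) = u"
  unfolding cell_of_def
  using bij_betw_imp_inj_on[OF bij_betw_label] by (rule inv_into_f_f)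

lemma label_inj: "u \<in> cells lam \<Longrightarrow> v \<in> cells lam \<Longrightarrow> label lam u = label lam v \<longleftrightarrow> u = v"
  using bij_betw_imp_inj_on[OF bij_betw_label] by (rule inj_on_eq_iff)

lemma label_image: "label lam ` cells lam = {1..sum_list lam}"
  using bij_betw_label by (rule bij_betw_imp_surj_on)

lemma cells_down_closed:
  assumes "is_partition lam" "(r, c) \<in> cells lam" "1 \<le> r'" "r' \<le> r" "1 \<le> c'" "c' \<le> c"
  shows "(r', c') \<in> cells lam"
proof -
  have "lam ! (r' - 1) \<ge> lam ! (r - 1)"
  proof (cases "r' = r")
    case False
    then show ?thesis
      using assms sorted_wrt_nth_less[of "(\<ge>)" lam "r' - 1" "r - 1"]
      by (auto simp: is_partition_def cells_def)
  qed simp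
  then show ?thesis using assms by (auto simp: cells_def)
qed

lemma partial_order_shape_poset: "partial_order_on {1..sum_list lam} (shape_poset lam)"
proof -
  have "refl_on {1..sum_list lam} (shape_poset lam)"
  proof (rule refl_onI)
    fix x assume "x \<in> {1..sum_list lam}"
    then obtain u where "u \<in> cells lam" "x = label lam u"
      using label_image[of lam] by blast
    then show "(x, x) \<in> shape_poset lam"
      unfolding shape_poset_def by (cases u) blast
  qed
  moreover have "shape_poset lam \<subseteq> {1..sum_list lam} \<times> {1..sum_list lam}"
    unfolding shape_poset_def label_image[symmetric] by blast
  moreover have "trans (shape_poset lam)"
  proof (rule transI)
    fix i j k assume "(i, j) \<in> shape_poset lam" "(j, k) \<in> shape_poset lam"
    then obtain r c r' c' r'' c'' where
      "i = label lam (r, c)" "k = label lam (r'', c'')"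
      "(r, c) \<in> cells lam" "(r'', c'') \<in> cells lam" "r \<le> r'" "r' \<le> r''" "c \<le> c'" "c' \<le> c''"
      unfolding shape_poset_def using label_inj[of _ lam] by blast
    then show "(i, k) \<in> shape_poset lam"
      unfolding shape_poset_def using order_trans by blast
  qed
  moreover have "antisym (shape_poset lam)"
  proof (rule antisymI)
    fix i j assume "(i, j) \<in> shape_poset lam" "(j, i) \<in> shape_poset lam"
    then obtain r c r' c' where
      "i = label lam (r, c)" "j = label lam (r', c')" "r \<le> r'" "r' \<le> r" "c \<le> c'" "c' \<le> c"
      unfolding shape_poset_def using label_inj[of _ lam] by blast
    then show "i = j" by simp
  qed
  ultimately show ?thesis by (auto simp: partial_order_on_def preorder_on_def)
qed

lemma SSYT_mono:
  assumes lam: "is_partition lam" and S: "S \<in> SSYT lam"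
    and u: "(r, c) \<in> cells lam" and v: "(r', c') \<in> cells lam" and le: "r \<le> r'" "c \<le> c'"
  shows "S (r, c) \<le> S (r', c')"
proof -
  have w: "(r, c') \<in> cells lam"
    using cells_down_closed[OF lam v, of r c'] u v le by (auto simp: cells_def)
  have "S (r, c) \<le> S (r, c')"
    using S u w le by (cases "c = c'") (auto simp: SSYT_def)
  also have "\<dots> \<le> S (r', c')"
    using S v w le by (cases "r = r'") (auto simp: SSYT_def intro: less_imp_le)
  finally show ?thesis .
qed

lemma linear_extension_tableau_order:
  assumes lam: "is_partition lam" and T: "T \<in> SYT lam"
  shows "linear_extension (sum_list lam) (shape_poset lam) (tableau_order lam T)"
proof -
  let ?L = "tableau_order lam T"
  have inj: "T u = T v \<longleftrightarrow> u = v" if "u \<in> cells lam" "v \<in> cells lam" for u v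
    using T that by (auto simp: SYT_def bij_betw_def inj_on_def)
  have "refl_on {1..sum_list lam} ?L"
  proof (rule refl_onI)
    fix x assume "x \<in> {1..sum_list lam}"
    then obtain u where "u \<in> cells lam" "x = label lam u"
      using label_image[of lam] by blast
    then show "(x, x) \<in> ?L"
      unfolding tableau_order_def by blast
  qed
  moreover have "?L \<subseteq> {1..sum_list lam} \<times> {1..sum_list lam}"
    unfolding tableau_order_def label_image[symmetric] by blast
  moreover have "trans ?L"
  proof (rule transI)
    fix i j k assume "(i, j) \<in> ?L" "(j, k) \<in> ?L"
    then obtain u v w where
      "i = label lam u" "k = label lam w" "u \<in> cells lam" "w \<in> cells lam" "T u \<le> T v" "T v \<le> T w"
      unfolding tableau_order_def using label_inj[of _ lam] by blast
    then show "(i, k) \<in> ?L"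
      unfolding tableau_order_def using order_trans by blast
  qed
  moreover have "antisym ?L"
  proof (rule antisymI)
    fix i j assume "(i, j) \<in> ?L" "(j, i) \<in> ?L"
    then obtain u v where
      uv: "i = label lam u" "j = label lam v" "u \<in> cells lam" "v \<in> cells lam" "T u \<le> T v" "T v \<le> T u"
      unfolding tableau_order_def using label_inj[of _ lam] by blast
    then show "i = j" using inj[of u v] by simp
  qed
  moreover have "total_on {1..sum_list lam} ?L"
  proof (rule total_onI)
    fix x y assume "x \<in> {1..sum_list lam}" "y \<in> {1..sum_list lam}"
    then obtain u v where "u \<in> cells lam" "x = label lam u" "v \<in> cells lam" "y = label lam v"
      using label_image[of lam] by blast
    then show "(x, y) \<in> ?L \<or> (y, x) \<in> ?L"
      unfolding tableau_order_def using linear[of "T u" "T v"] by blast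
  qed
  moreover have "shape_poset lam \<subseteq> ?L"
  proof -
    have "T \<in> SSYT lam" using T by (simp add: SYT_def)
    from SSYT_mono[OF lam this] show ?thesis
      unfolding shape_poset_def tableau_order_def by blast
  qed
  ultimately show ?thesis
    by (auto simp: linear_extension_def linear_order_on_def partial_order_on_def preorder_on_def)
qed


section \<open>The composition \<open>red(L, \<rho>)\<close>\<close>

definition kept_edges :: "nat rel \<Rightarrow> nat rel" where
  "kept_edges L = {(i, j). covers L i j \<and> \<not> i > j}"

text \<open>
  The chains \<open>C\<^sub>1, \<dots>, C\<^sub>r\<close> are the connected components of the Hasse diagram
  after the removal of edges.
\<close>

definition red_chains :: "nat \<Rightarrow> nat rel \<Rightarrow> nat set set" where
  "red_chains p L = {1..p} // (kept_edges L \<union> (kept_edges L)\<inverse>)\<^sup>*"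

definition min_wrt :: "nat rel \<Rightarrow> nat set \<Rightarrow> nat" where
  "min_wrt L C = (THE m. m \<in> C \<and> (\<forall>x\<in>C. (m, x) \<in> L))"

definition chain_pos :: "nat rel \<Rightarrow> (nat \<Rightarrow> int) \<Rightarrow> nat set \<Rightarrow> int" where
  "chain_pos L \<rho> C = rho_bar L \<rho> (min_wrt L C)"

text \<open>
  Meaningful when \<open>L\<close> is a linear order on \<open>{1..p}\<close> with \<open>rho_bar L \<rho> \<ge> 1\<close> on \<open>{1..p}\<close>.
  The positions \<open>c\<^sub>s\<close> then strictly increase with \<open>s\<close>, so each sum below has at most one
  summand and is the part \<open>\<bar>C\<^sub>s\<bar>\<close> or 0. The list ends with the part in position \<open>c\<^sub>r\<close>.
\<close>

definition red :: "nat \<Rightarrow> nat rel \<Rightarrow> (nat \<Rightarrow> int) \<Rightarrow> nat list" where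
  "red p L \<rho> =
     map (\<lambda>k. \<Sum>C | C \<in> red_chains p L \<and> chain_pos L \<rho> C = int k. card C)
       [1..<Suc (Max (insert 0 ((\<lambda>C. nat (chain_pos L \<rho> C)) ` red_chains p L)))]"


section \<open>Slide polynomials\<close>

definition flat :: "nat list \<Rightarrow> nat list" where
  "flat a = filter (\<lambda>x. x \<noteq> 0) a"

definition refines :: "nat list \<Rightarrow> nat list \<Rightarrow> bool" where
  "refines \<beta> \<alpha> \<longleftrightarrow> sum_list \<beta> = sum_list \<alpha> \<and>
     (\<forall>j\<le>length \<alpha>. \<exists>i\<le>length \<beta>. sum_list (take j \<alpha>) = sum_list (take i \<beta>))"

definition dominates :: "nat list \<Rightarrow> nat list \<Rightarrow> bool" where
  "dominates b a \<longleftrightarrow> (\<forall>k. sum_list (take k b) \<ge> sum_list (take k a))"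

definition slide :: "nat list \<Rightarrow> int_mpoly" where
  "slide a =
     (\<Sum>b | length b = length a \<and> dominates b a \<and> refines (flat b) (flat a).
        \<Prod>k=1..length a. X k ^ (b ! (k - 1)))"

end

theory Submission
  imports Defs "HOL-Library.Product_Lexorder"
begin

text \<open>
  The first equality is standardization. Reading a flagged semistandard tableau \<open>S\<close> as a
  function \<open>f\<close> on labels, sort the cells by the pair (entry, label); the ranks form a standard
  tableau \<open>T\<close>: labels grow along rows, so weak growth of \<open>S\<close> along rows and strict growth down
  columns both become growth of the pair. Conversely, if \<open>f\<close> is a partition of the linear order
  of a standard tableau \<open>T\<close>, then \<open>f\<close> gives a semistandard filling, because labels shrink down
  columns and so force strict growth there. Moreover \<open>T\<close> sorts the cells by the pair and is
  therefore the standardization of that filling (\<open>P_partition_tableau_key\<close>). The flag is the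
  same bound on both sides, which gives \<open>flagged_schur_eq_sum_P_partition_gf\<close>.

  The second equality holds term by term. Write a linear order on \<open>{1..p}\<close> as a word \<open>w\<close>, and
  let \<open>d i\<close> be the number of descents of \<open>w\<close> before position \<open>i\<close>, so that the chains
  \<open>C\<^sub>s\<close> are the level sets of \<open>d\<close>. The number \<open>rho_bar (w i) - d i\<close> is the minimum of
  \<open>\<rho> (w j) - d j\<close> over \<open>j \<ge> i\<close>, hence weakly increasing in \<open>i\<close>. Along a run of the tableau
  word the labels increase, so the cells move weakly upwards and, the flag being sorted,
  \<open>\<rho>\<close> weakly decreases; the minimum is then the same for all positions of the run. Therefore
  \<open>h i = rho_bar (w i)\<close> is a weakly increasing word that is constant on runs and jumps between
  them, and \<open>red\<close> is its content, the list of multiplicities of its letters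
  (\<open>red_eq_content\<close>). A partition \<open>f\<close> of the order is in turn a weakly increasing word
  \<open>g = f \<circ> w\<close> with \<open>g \<le> h\<close> that jumps wherever \<open>h\<close> does (\<open>P_partitions_iff_tightens\<close>).
  Passing to contents, \<open>g \<le> h\<close> becomes dominance and the jump condition becomes refinement
  (\<open>slide_index_iff_tightens\<close>), because the partial sums of a content are the positions at which
  the word passes from one letter to the next. A weakly increasing word is determined by its
  content, so the contents of these \<open>g\<close> are the exponent vectors of the slide polynomial. If
  some \<open>rho_bar\<close> is not positive, no \<open>f\<close> exists and both sides vanish.
\<close>

section \<open>Weakly increasing words and their contents\<close>

definition content :: "nat \<Rightarrow> nat \<Rightarrow> (nat \<Rightarrow> nat) \<Rightarrow> nat list" where
  "content n p g = map (\<lambda>k. card {i. i < p \<and> g i = k}) [1..<Suc n]"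

text \<open>
  The inverse of \<open>content\<close>: the weakly increasing word with \<open>b ! 0\<close> letters 1, then \<open>b ! 1\<close>
  letters 2, and so on. Letter \<open>i\<close> is at most \<open>k\<close> iff \<open>i\<close> lies in the first \<open>k\<close> blocks.
\<close>

definition word_of :: "nat list \<Rightarrow> nat \<Rightarrow> nat" where
  "word_of b i = (LEAST k. i < sum_list (take k b))"

text \<open>
  The word-level form of the index set of a slide polynomial: if \<open>h\<close> has content \<open>a\<close>, then the
  words \<open>g\<close> below are those whose contents index the monomials of \<open>slide a\<close>.
\<close>

definition tightens :: "nat \<Rightarrow> (nat \<Rightarrow> nat) \<Rightarrow> (nat \<Rightarrow> nat) \<Rightarrow> bool" where
  "tightens p g h \<longleftrightarrow> mono_on {..<p} g \<and>
     (\<forall>i<p. 1 \<le> g i \<and> g i \<le> h i) \<and> (\<forall>i<p. \<forall>j<p. h i < h j \<longrightarrow> g i < g j)"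

lemma length_content [simp]: "length (content n p g) = n"
  by (simp add: content_def)

lemma nth_content: "k < n \<Longrightarrow> content n p g ! k = card {i. i < p \<and> g i = Suc k}"
  by (simp add: content_def del: upt_Suc)

lemma sum_list_take_content:
  assumes "\<And>i. i < p \<Longrightarrow> 1 \<le> g i" "k \<le> n"
  shows "sum_list (take k (content n p g)) = card {i. i < p \<and> g i \<le> k}"
  using assms(2)
proof (induction k)
  case 0
  have "{i. i < p \<and> g i \<le> 0} = {}" using assms(1) by fastforce
  then show ?case by (metis card.empty sum_list.Nil take_0)
next
  case (Suc k)
  have eq: "{i. i < p \<and> g i \<le> Suc k} = {i. i < p \<and> g i \<le> k} \<union> {i. i < p \<and> g i = Suc k}" by auto
  have "card {i. i < p \<and> g i \<le> Suc k} = card {i. i < p \<and> g i \<le> k} + card {i. i < p \<and> g i = Suc k}"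
    unfolding eq by (rule card_Un_disjoint) auto
  then show ?case using Suc by (simp add: take_Suc_conv_app_nth nth_content)
qed

text \<open>
  In a weakly increasing word the letters \<open>\<le> k\<close> form an initial segment. This translates every
  comparison of letters into one of positions with partial sums of the content.
\<close>

lemma mono_word_le_iff:
  assumes "mono_on {..<p} (g :: nat \<Rightarrow> nat)" "i < p"
  shows "g i \<le> k \<longleftrightarrow> i < card {i. i < p \<and> g i \<le> k}"
proof
  assume "g i \<le> k"
  then have "{..i} \<subseteq> {i. i < p \<and> g i \<le> k}"
    using assms mono_onD[OF assms(1), of _ i] by (auto intro: order_trans)
  from card_mono[OF _ this] show "i < card {i. i < p \<and> g i \<le> k}" by simp
next
  assume less: "i < card {i. i < p \<and> g i \<le> k}"
  show "g i \<le> k"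
  proof (rule ccontr)
    assume "\<not> g i \<le> k"
    then have "{i. i < p \<and> g i \<le> k} \<subseteq> {..<i}"
      using assms(2) mono_onD[OF assms(1), of i] by (fastforce simp: not_le)
    from card_mono[OF _ this] show False using less by simp
  qed
qed

lemma mono_word_le_iff_content:
  assumes "mono_on {..<p} g" "\<And>i. i < p \<Longrightarrow> 1 \<le> g i" "i < p" "k \<le> n"
  shows "g i \<le> k \<longleftrightarrow> i < sum_list (take k (content n p g))"
  using mono_word_le_iff[OF assms(1,3)] sum_list_take_content[of p g, OF assms(2,4)] by simp

lemma sum_list_take_mono:
  assumes "j \<le> k"
  shows "sum_list (take j b) \<le> sum_list (take k (b :: nat list))"
proof -
  have "take k b = take j b @ take (k - j) (drop j b)"
    using assms by (metis le_add_diff_inverse take_add)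
  then show ?thesis by simp
qed

lemma word_of_le_iff:
  assumes "i < sum_list b"
  shows "word_of b i \<le> k \<longleftrightarrow> i < sum_list (take k b)"
proof
  have "i < sum_list (take (length b) b)" using assms by simp
  then have "i < sum_list (take (word_of b i) b)" unfolding word_of_def by (rule LeastI)
  then show "word_of b i \<le> k \<Longrightarrow> i < sum_list (take k b)"
    using sum_list_take_mono[of "word_of b i" k b] by linarith
  show "i < sum_list (take k b) \<Longrightarrow> word_of b i \<le> k"
    unfolding word_of_def by (rule Least_le)
qed

lemma mono_word_of: "mono_on {..<sum_list b} (word_of b)"
proof (rule mono_onI)
  fix i j assume "i \<in> {..<sum_list b}" "j \<in> {..<sum_list b}" "i \<le> j"
  then show "word_of b i \<le> word_of b j"
    using word_of_le_iff[of i b "word_of b j"] word_of_le_iff[of j b "word_of b j"] by simp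
qed

lemma word_of_ge_1: "i < sum_list b \<Longrightarrow> 1 \<le> word_of b i"
  using word_of_le_iff[of i b 0] by (cases "word_of b i") auto

lemma word_of_le_length: "i < sum_list b \<Longrightarrow> word_of b i \<le> length b"
  using word_of_le_iff[of i b "length b"] by simp

lemma content_word_of: "content (length b) (sum_list b) (word_of b) = b"
proof (rule nth_equalityI)
  fix k assume "k < length (content (length b) (sum_list b) (word_of b))"
  then have k: "k < length b" by simp
  have card: "card {i. i < sum_list b \<and> word_of b i \<le> j} = sum_list (take j b)" if "j \<le> length b" for j
  proof -
    have "{i. i < sum_list b \<and> word_of b i \<le> j} = {..<sum_list (take j b)}"
      using word_of_le_iff[of _ b j] sum_list_take_mono[of j "length b" b] that by fastforce
    then show ?thesis by simp
  qed
  have *: "sum_list (take j (content (length b) (sum_list b) (word_of b))) = sum_list (take j b)"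
    if "j \<le> length b" for j
    using sum_list_take_content[of "sum_list b" "word_of b" j "length b"] word_of_ge_1 card that by simp
  show "content (length b) (sum_list b) (word_of b) ! k = b ! k"
    using *[of k] *[of "Suc k"] k by (simp add: take_Suc_conv_app_nth)
qed simp

lemma sum_list_content:
  assumes "\<And>i. i < p \<Longrightarrow> 1 \<le> g i \<and> g i \<le> n"
  shows "sum_list (content n p g) = p"
proof -
  have "{i. i < p \<and> g i \<le> n} = {..<p}" using assms by auto
  then show ?thesis using sum_list_take_content[of p g n n] assms by simp
qed

lemma word_of_content:
  assumes "mono_on {..<p} g" "\<And>i. i < p \<Longrightarrow> 1 \<le> g i \<and> g i \<le> n" "i < p"
  shows "word_of (content n p g) i = g i"
proof -
  have sum: "sum_list (content n p g) = p"
    using assms(2) by (rule sum_list_content)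
  have "word_of (content n p g) i \<le> k \<longleftrightarrow> g i \<le> k" if "k \<le> n" for k
    using word_of_le_iff[of i "content n p g" k] mono_word_le_iff_content[of p g i k n] assms sum that by simp
  moreover have "word_of (content n p g) i \<le> n"
    using word_of_le_length[of i "content n p g"] assms(3) sum by simp
  ultimately show ?thesis using assms(2,3) by (meson le_antisym order_refl)
qed


section \<open>Refinement and dominance through words\<close>

text \<open>
  A zero part repeats a partial sum, so removing it leaves the set of partial sums unchanged.
  Refinement of flattened compositions can thus be tested on the compositions themselves.
\<close>

lemma partial_sums_flat:
  "(\<lambda>j. sum_list (take j (flat a))) ` {..length (flat a)} = (\<lambda>j. sum_list (take j a)) ` {..length a}"
proof (induction a)
  case Nil
  then show ?case by (simp add: flat_def)
next
  case (Cons x a)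
  have split: "(\<lambda>j. sum_list (take j (y # ys))) ` {..length (y # ys)} =
      insert 0 ((+) y ` (\<lambda>j. sum_list (take j ys)) ` {..length ys})" for y :: nat and ys
    by (simp add: atMost_Suc_eq_insert_0 image_image)
  show ?case
  proof (cases "x = 0")
    case True
    have "0 \<in> (\<lambda>j. sum_list (take j a)) ` {..length a}" by (rule image_eqI[where x = 0]) auto
    then have "insert 0 ((+) x ` (\<lambda>j. sum_list (take j a)) ` {..length a}) = (\<lambda>j. sum_list (take j a)) ` {..length a}"
      using True by (auto simp: image_image)
    then show ?thesis using split[of x a] Cons True by (simp add: flat_def)
  next
    case False
    then have "flat (x # a) = x # flat a" by (simp add: flat_def)
    then show ?thesis using split[of x a] split[of x "flat a"] Cons by simp
  qed
qed

lemma sum_list_flat: "sum_list (flat a) = sum_list a"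
  by (induction a) (auto simp: flat_def)

lemma refines_flat_iff:
  "refines (flat b) (flat a) \<longleftrightarrow> sum_list b = sum_list a \<and>
     (\<forall>j\<le>length a. \<exists>i\<le>length b. sum_list (take j a) = sum_list (take i b))"
proof -
  have *: "(\<forall>j\<le>length x. \<exists>i\<le>length y. sum_list (take j x) = sum_list (take i y)) \<longleftrightarrow>
      (\<lambda>j. sum_list (take j x)) ` {..length x} \<subseteq> (\<lambda>j. sum_list (take j y)) ` {..length y}"
    for x y :: "nat list"
    by (auto simp: image_subset_iff image_iff)
  show ?thesis unfolding refines_def * sum_list_flat partial_sums_flat ..
qed

text \<open>
  Let \<open>A\<close> and \<open>B\<close> be the partial sums of the two contents. Then \<open>h i \<le> k\<close> iff \<open>i < A k\<close>, and
  \<open>g i \<le> k\<close> iff \<open>i < B k\<close>. Hence \<open>g \<le> h\<close> says \<open>A \<le> B\<close>. The values of \<open>A\<close> strictly between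
  0 and \<open>p\<close> are the positions at which \<open>h\<close> jumps, so \<open>g\<close> jumps at all of them iff every value
  of \<open>A\<close> is a value of \<open>B\<close>.
\<close>

lemma slide_index_iff_tightens:
  assumes g: "mono_on {..<p} g" "\<And>i. i < p \<Longrightarrow> 1 \<le> g i \<and> g i \<le> n"
    and h: "mono_on {..<p} h" "\<And>i. i < p \<Longrightarrow> 1 \<le> h i \<and> h i \<le> n"
  shows "dominates (content n p g) (content n p h) \<and> refines (flat (content n p g)) (flat (content n p h))
     \<longleftrightarrow> tightens p g h"
proof -
  define A B where "A k = sum_list (take k (content n p h))" and "B k = sum_list (take k (content n p g))" for k
  have A: "h i \<le> k \<longleftrightarrow> i < A k" if "i < p" "k \<le> n" for i k
    unfolding A_def using mono_word_le_iff_content[of p h i k n] h that by auto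
  have B: "g i \<le> k \<longleftrightarrow> i < B k" if "i < p" "k \<le> n" for i k
    unfolding B_def using mono_word_le_iff_content[of p g i k n] g that by auto
  have cA: "A k = card {i. i < p \<and> h i \<le> k}" if "k \<le> n" for k
    unfolding A_def using sum_list_take_content[of p h k n] h that by auto
  have cB: "B k = card {i. i < p \<and> g i \<le> k}" if "k \<le> n" for k
    unfolding B_def using sum_list_take_content[of p g k n] g that by auto
  have sumA: "sum_list (content n p h) = p" and sumB: "sum_list (content n p g) = p"
    using sum_list_content g h by auto
  have An: "A k = p" "B k = p" if "n \<le> k" for k
    using sumA sumB that by (simp_all add: A_def B_def)
  have Ap: "A k \<le> p" for k
    unfolding A_def using sumA sum_list_take_mono[of k "max k n" "content n p h"] by simp
  have dom: "dominates (content n p g) (content n p h) \<longleftrightarrow> (\<forall>i<p. g i \<le> h i)"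
  proof
    assume "dominates (content n p g) (content n p h)"
    then have AB: "A k \<le> B k" for k by (simp add: dominates_def A_def B_def)
    show "\<forall>i<p. g i \<le> h i"
    proof (intro allI impI)
      fix i assume "i < p"
      then show "g i \<le> h i" using A[of i "h i"] B[of i "h i"] AB[of "h i"] h(2)[of i] by simp
    qed
  next
    assume le: "\<forall>i<p. g i \<le> h i"
    have "A k \<le> B k" for k
    proof (cases "k \<le> n")
      case True
      have "{i. i < p \<and> h i \<le> k} \<subseteq> {i. i < p \<and> g i \<le> k}" using le order_trans by blast
      then show ?thesis unfolding cA[OF True] cB[OF True] by (intro card_mono) auto
    qed (simp add: An)
    then show "dominates (content n p g) (content n p h)" by (simp add: dominates_def A_def B_def)
  qed
  have ref: "refines (flat (content n p g)) (flat (content n p h)) \<longleftrightarrow> (\<forall>i<p. \<forall>j<p. h i < h j \<longrightarrow> g i < g j)"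
  proof
    assume "refines (flat (content n p g)) (flat (content n p h))"
    then have ex: "\<exists>i\<le>n. A k = B i" if "k \<le> n" for k
      using that by (simp add: refines_flat_iff A_def B_def)
    show "\<forall>i<p. \<forall>j<p. h i < h j \<longrightarrow> g i < g j"
    proof (intro allI impI)
      fix i j assume ij: "i < p" "j < p" "h i < h j"
      obtain k where k: "k \<le> n" "A (h i) = B k" using ex h(2)[OF ij(1)] by blast
      have "i < B k" "\<not> j < B k" using A[of i "h i"] A[of j "h i"] ij h(2)[OF ij(1)] k by auto
      then show "g i < g j" using B[of i k] B[of j k] ij k by simp
    qed
  next
    assume strict: "\<forall>i<p. \<forall>j<p. h i < h j \<longrightarrow> g i < g j"
    have "\<exists>i\<le>n. A k = B i" if "k \<le> n" for k
    proof -
      consider "A k = 0" | "A k = p" | "0 < A k" "A k < p" using Ap[of k] by linarith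
      then show ?thesis
      proof cases
        case 1
        then show ?thesis by (intro exI[of _ 0]) (simp add: B_def)
      next
        case 2
        then show ?thesis using An(2)[of n] by (intro exI[of _ n]) simp
      next
        case 3
        \<comment> \<open>Position \<open>A k\<close> is a jump of \<open>h\<close>, hence of \<open>g\<close>; as \<open>g\<close> is weakly increasing, the number
          of its letters up to the one just before the jump is \<open>A k\<close>.\<close>
        define i where "i = A k - 1"
        have i: "Suc i = A k" "i < p" "Suc i < p" using 3 by (simp_all add: i_def)
        have "h i \<le> k" "\<not> h (Suc i) \<le> k" using A i that by auto
        then have "g i < g (Suc i)" using strict i by simp
        then have "i < B (g i)" "\<not> Suc i < B (g i)" using B[of i "g i"] B[of "Suc i" "g i"] i g(2)[of i] by auto
        then show ?thesis using i g(2)[of i] by (intro exI[of _ "g i"]) auto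
      qed
    qed
    then show "refines (flat (content n p g)) (flat (content n p h))"
      using sumA sumB by (simp add: refines_flat_iff A_def B_def)
  qed
  show ?thesis using dom ref g by (auto simp: tightens_def)
qed


section \<open>Descents of the word of a linear order\<close>

text \<open>
  Besides counting descents, \<open>descents w i\<close> is the index of the ascending run of \<open>w\<close> that
  contains position \<open>i\<close>, and differences of it count the descents of an interval.
\<close>

definition descents :: "(nat \<Rightarrow> nat) \<Rightarrow> nat \<Rightarrow> nat" where
  "descents w i = card {t. t < i \<and> w (Suc t) < w t}"

text \<open>
  Every linear order on a finite set of numbers arises in this way, with \<open>w\<close> listing the elements in
  increasing order. Positions start at 0.
\<close>

definition word_order :: "nat \<Rightarrow> (nat \<Rightarrow> nat) \<Rightarrow> nat rel" where
  "word_order p w = {(w i, w j) | i j. i \<le> j \<and> j < p}"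

lemma descents_Suc: "descents w (Suc i) = descents w i + of_bool (w (Suc i) < w i)"
proof -
  have "{t. t < Suc i \<and> w (Suc t) < w t} =
      (if w (Suc i) < w i then insert i {t. t < i \<and> w (Suc t) < w t} else {t. t < i \<and> w (Suc t) < w t})"
    by (auto simp: less_Suc_eq)
  then show ?thesis by (simp add: descents_def)
qed

lemma descents_mono: "i \<le> j \<Longrightarrow> descents w i \<le> descents w j"
  by (rule lift_Suc_mono_le[of "descents w"]) (simp_all add: descents_Suc)

text \<open>
  Equal descent counts mean that no descent separates the two positions, so only the
  ascending steps between them need to be controlled.
\<close>

lemma ascending_run:
  fixes \<phi> :: "nat \<Rightarrow> 'a :: preorder"
  assumes "i \<le> j" "descents w i = descents w j"
    and step: "\<And>t. i \<le> t \<Longrightarrow> t < j \<Longrightarrow> w t \<le> w (Suc t) \<Longrightarrow> \<phi> t \<le> \<phi> (Suc t)"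
  shows "\<phi> i \<le> \<phi> j"
  using assms(1,2) step
proof (induction j rule: dec_induct)
  case (step j)
  have "descents w i \<le> descents w j" "descents w j \<le> descents w (Suc j)"
    using step.hyps by (simp_all add: descents_mono)
  then have eq: "descents w i = descents w j" "descents w j = descents w (Suc j)"
    using step.prems by simp_all
  then have "\<phi> i \<le> \<phi> j" using step.IH step.prems(2) by simp
  also have "w j \<le> w (Suc j)" using eq(2) by (simp add: descents_Suc split: if_splits)
  then have "\<phi> j \<le> \<phi> (Suc j)" using step by simp
  finally show ?case .
qed simp

lemma descent_between:
  assumes "descents w i < descents w j"
  obtains t where "i \<le> t" "t < j" "w (Suc t) < w t"
proof -
  have "i \<le> j" using assms descents_mono[of j i w] by (meson leD linear)
  have "\<exists>t. i \<le> t \<and> t < j \<and> w (Suc t) < w t"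
  proof (rule ccontr)
    assume "\<not> ?thesis"
    then have "{t. t < i \<and> w (Suc t) < w t} = {t. t < j \<and> w (Suc t) < w t}"
      using \<open>i \<le> j\<close> by (meson leI order_less_le_trans)
    then show False using assms by (simp add: descents_def)
  qed
  then show ?thesis using that by blast
qed

lemma num_descents_Cons:
  "num_descents (x # y # zs) = of_bool (y < x) + num_descents (y # zs)"
proof -
  let ?D = "{t. Suc t < length (y # zs) \<and> (y # zs) ! t > (y # zs) ! Suc t}"
  have fin: "finite ?D" by (rule finite_subset[of _ "{..<length (y # zs)}"]) auto
  have "{t. Suc t < length (x # y # zs) \<and> (x # y # zs) ! t > (x # y # zs) ! Suc t} =
      (if y < x then insert 0 (Suc ` ?D) else Suc ` ?D)"
  proof -
    have "t \<in> {t. Suc t < length (x # y # zs) \<and> (x # y # zs) ! t > (x # y # zs) ! Suc t} \<longleftrightarrow>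
      t \<in> (if y < x then insert 0 (Suc ` ?D) else Suc ` ?D)" for t
      by (cases t) (auto simp: image_iff)
    then show ?thesis by blast
  qed
  then have "num_descents (x # y # zs) = card (if y < x then insert 0 (Suc ` ?D) else Suc ` ?D)"
    unfolding num_descents_def by (rule arg_cong)
  also have "\<dots> = of_bool (y < x) + card ?D"
    using fin by (auto simp: card_image)
  finally show ?thesis by (simp add: num_descents_def)
qed

lemma num_descents_single [simp]: "num_descents [x] = 0"
  by (simp add: num_descents_def)


locale permutation_word =
  fixes p :: nat and w :: "nat \<Rightarrow> nat"
  assumes bij: "bij_betw w {..<p} {1..p}"
begin

abbreviation L where "L \<equiv> word_order p w"
abbreviation d where "d \<equiv> descents w"

lemma w_eq_iff: "i < p \<Longrightarrow> j < p \<Longrightarrow> w i = w j \<longleftrightarrow> i = j"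
  using bij by (auto simp: bij_betw_def inj_on_def)

lemma w_image: "w ` {..<p} = {1..p}"
  using bij by (simp add: bij_betw_def)

lemma L_iff: "i < p \<Longrightarrow> j < p \<Longrightarrow> (w i, w j) \<in> L \<longleftrightarrow> i \<le> j"
  unfolding word_order_def using w_eq_iff by fastforce

lemma strict_less_iff: "i < p \<Longrightarrow> j < p \<Longrightarrow> strict_less L (w i) (w j) \<longleftrightarrow> i < j"
  using L_iff w_eq_iff by (auto simp: strict_less_def)

lemma strict_lessE:
  assumes "strict_less L x y"
  obtains i j where "x = w i" "y = w j" "i < j" "j < p"
  using assms unfolding strict_less_def word_order_def by (auto simp: le_less)

lemma covers_iff: "covers L x y \<longleftrightarrow> (\<exists>i. Suc i < p \<and> x = w i \<and> y = w (Suc i))"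
proof
  assume cov: "covers L x y"
  then obtain i j where ij: "x = w i" "y = w j" "i < j" "j < p"
    unfolding covers_def by (elim conjE strict_lessE)
  have "j = Suc i"
  proof (rule ccontr)
    assume "j \<noteq> Suc i"
    then have "strict_less L x (w (Suc i))" "strict_less L (w (Suc i)) y"
      using ij by (simp_all add: strict_less_iff)
    then show False using cov unfolding covers_def by blast
  qed
  then show "\<exists>i. Suc i < p \<and> x = w i \<and> y = w (Suc i)" using ij by blast
next
  assume "\<exists>i. Suc i < p \<and> x = w i \<and> y = w (Suc i)"
  then obtain i where i: "Suc i < p" "x = w i" "y = w (Suc i)" by blast
  have "\<not> (strict_less L x z \<and> strict_less L z y)" for z
  proof
    assume *: "strict_less L x z \<and> strict_less L z y"
    then obtain k where "z = w k" "k < p" by (metis strict_lessE)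
    then have "i < k" "k < Suc i" using * i by (simp_all add: strict_less_iff)
    then show False by linarith
  qed
  then show "covers L x y" using i by (simp add: covers_def strict_less_iff)
qed

lemma less_imp_descent:
  assumes "i < j" "w j < w i"
  shows "d i < d j"
proof (rule ccontr)
  assume "\<not> d i < d j"
  then have "d i = d j" using descents_mono[of i j w] assms(1) by simp
  then have "w i \<le> w j" using ascending_run[of i j w w] assms(1) by simp
  then show False using assms(2) by simp
qed

text \<open>
  A step of a chain that is a descent in the labels jumps over at least one descent of \<open>w\<close>,
  and different steps jump over disjoint stretches of \<open>w\<close>.
\<close>

lemma num_descents_chain_le:
  assumes "successively (strict_less L) xs" "xs \<noteq> []" "hd xs = w i" "last xs = w j" "i < p" "j < p"
  shows "num_descents xs + d i \<le> d j"
  using assms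
proof (induction xs arbitrary: i)
  case (Cons x xs)
  show ?case
  proof (cases xs)
    case Nil
    then show ?thesis using Cons.prems w_eq_iff[of i j] by simp
  next
    case (Cons y zs)
    have "strict_less L x y" using Cons.prems(1) Cons by simp
    then obtain k where k: "y = w k" "i < k" "k < p"
      using Cons.prems w_eq_iff by (elim strict_lessE) auto
    have "num_descents (y # zs) + d k \<le> d j"
      using Cons.IH[of k] Cons.prems k Cons by simp
    moreover have "of_bool (y < x) + d i \<le> d k"
      using less_imp_descent[of i k] descents_mono[of i k w] k Cons.prems(3) by (auto simp: of_bool_def)
    ultimately show ?thesis using Cons by (simp add: num_descents_Cons)
  qed
qed simp

lemma num_descents_segment:
  assumes "i \<le> j"
  shows "num_descents (map w [i..<Suc j]) + d i = d j"
  using assms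
proof (induction i rule: inc_induct)
  case (step i)
  have "map w [i..<Suc j] = w i # w (Suc i) # map w [Suc (Suc i)..<Suc j]"
    using step.hyps by (simp add: upt_conv_Cons del: upt_Suc)
  moreover have "map w [Suc i..<Suc j] = w (Suc i) # map w [Suc (Suc i)..<Suc j]"
    using step.hyps by (simp add: upt_conv_Cons del: upt_Suc)
  ultimately have "num_descents (map w [i..<Suc j]) = of_bool (w (Suc i) < w i) + num_descents (map w [Suc i..<Suc j])"
    by (simp only: num_descents_Cons)
  then show ?case using step.IH by (simp add: descents_Suc)
qed simp

text \<open>
  The chain through all positions from \<open>i\<close> to \<open>j\<close> attains the bound for arbitrary chains.
\<close>

lemma max_descents_eq:
  assumes "i \<le> j" "j < p"
  shows "max_descents L (w i) (w j) = d j - d i"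
  unfolding max_descents_def
proof (rule Max_eqI)
  have le: "y \<le> d j - d i" if y: "y \<in> num_descents ` poset_chains L (w i) (w j)" for y
  proof -
    obtain xs where "xs \<in> poset_chains L (w i) (w j)" "y = num_descents xs" using y by blast
    then show ?thesis
      using num_descents_chain_le[of xs i j] assms by (simp add: poset_chains_def)
  qed
  show "y \<le> d j - d i" if "y \<in> num_descents ` poset_chains L (w i) (w j)" for y
    using that by (rule le)
  show "finite (num_descents ` poset_chains L (w i) (w j))"
    by (rule finite_subset[of _ "{..d j - d i}"], rule subsetI, unfold atMost_iff, rule le) simp_all
  have "successively (strict_less L) (map w [i..<Suc j])"
    unfolding successively_conv_nth
  proof (intro allI impI)
    fix t assume "Suc t < length (map w [i..<Suc j])"
    then have t: "i + Suc t < Suc j" by (simp del: upt_Suc)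
    then have "map w [i..<Suc j] ! t = w (i + t)" "map w [i..<Suc j] ! Suc t = w (i + Suc t)"
      by (simp_all del: upt_Suc)
    then show "strict_less L (map w [i..<Suc j] ! t) (map w [i..<Suc j] ! Suc t)"
      using strict_less_iff[of "i + t" "i + Suc t"] t assms by (simp del: upt_Suc)
  qed
  then have "map w [i..<Suc j] \<in> poset_chains L (w i) (w j)"
    using assms by (simp add: poset_chains_def hd_map last_map del: upt_Suc)
  moreover have "d j - d i = num_descents (map w [i..<Suc j])"
    using num_descents_segment[OF assms(1)] by simp
  ultimately show "d j - d i \<in> num_descents ` poset_chains L (w i) (w j)" by blast
qed

lemma rho_bar_eq:
  assumes "i < p"
  shows "rho_bar L \<rho> (w i) = Min ((\<lambda>j. \<rho> (w j) - int (d j) + int (d i)) ` {i..<p})"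
proof -
  have "{\<rho> x - int (max_descents L (w i) x) | x. (w i, x) \<in> L} =
      (\<lambda>j. \<rho> (w j) - int (max_descents L (w i) (w j))) ` {i..<p}"
  proof -
    have "{x. (w i, x) \<in> L} = w ` {i..<p}"
      unfolding word_order_def using w_eq_iff assms by fastforce
    then have "(\<lambda>x. \<rho> x - int (max_descents L (w i) x)) ` {x. (w i, x) \<in> L} =
       (\<lambda>x. \<rho> x - int (max_descents L (w i) x)) ` w ` {i..<p}" by simp
    then show ?thesis by (simp add: image_image setcompr_eq_image)
  qed
  also have "\<dots> = (\<lambda>j. \<rho> (w j) - int (d j) + int (d i)) ` {i..<p}"
    using descents_mono[of i _ w] by (intro image_cong) (auto simp: max_descents_eq of_nat_diff)
  finally show ?thesis by (simp add: rho_bar_def)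
qed

lemma rho_bar_le: "i \<le> j \<Longrightarrow> j < p \<Longrightarrow> rho_bar L \<rho> (w i) \<le> \<rho> (w j) - int (d j) + int (d i)"
  by (subst rho_bar_eq) (auto intro!: Min_le)

lemma rho_bar_attained:
  assumes "i < p"
  obtains j where "i \<le> j" "j < p" "rho_bar L \<rho> (w i) = \<rho> (w j) - int (d j) + int (d i)"
proof -
  let ?A = "(\<lambda>j. \<rho> (w j) - int (d j) + int (d i)) ` {i..<p}"
  have "Min ?A \<in> ?A" using assms by (intro Min_in) auto
  then show ?thesis using that rho_bar_eq[OF assms, of \<rho>] by auto
qed

text \<open>
  After subtracting \<open>d i\<close>, the quantity minimized in \<open>rho_bar\<close> no longer depends on \<open>i\<close>, and
  moving \<open>i\<close> to the right only shrinks the range of the minimum.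
\<close>

lemma rho_bar_shifted_mono:
  assumes "i \<le> j" "j < p"
  shows "rho_bar L \<rho> (w i) - int (d i) \<le> rho_bar L \<rho> (w j) - int (d j)"
proof -
  obtain k where "j \<le> k" "k < p" "rho_bar L \<rho> (w j) = \<rho> (w k) - int (d k) + int (d j)"
    using rho_bar_attained[OF assms(2)] .
  then show ?thesis using rho_bar_le[of i k \<rho>] assms by simp
qed

text \<open>
  The bound \<open>\<rho>\<close> may be replaced by the smaller \<open>rho_bar\<close>: between \<open>i\<close> and \<open>j\<close> the values of \<open>f\<close>
  grow by at least the number of descents, so each bound \<open>f (w j) \<le> \<rho> (w j)\<close> forces
  \<open>f (w i) \<le> \<rho> (w j) - (d j - d i)\<close>.
\<close>

lemma P_partitions_iff:
  "f \<in> P_partitions p L \<rho> \<longleftrightarrow> f \<in> {1..p} \<rightarrow>\<^sub>E {1..} \<and> mono_on {..<p} (f \<circ> w) \<and>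
     (\<forall>i<p. \<forall>j<p. d i < d j \<longrightarrow> f (w i) < f (w j)) \<and> (\<forall>i<p. int (f (w i)) \<le> rho_bar L \<rho> (w i))"
  (is "_ \<longleftrightarrow> ?R")
proof
  assume f: "f \<in> P_partitions p L \<rho>"
  have le: "f (w i) \<le> f (w j)" if "i \<le> j" "j < p" for i j
    using f strict_less_iff[of i j] that by (cases "i = j") (auto simp: P_partitions_def)
  have less: "f (w i) < f (w (Suc i))" if "w (Suc i) < w i" "Suc i < p" for i
    using f strict_less_iff[of i "Suc i"] that by (auto simp: P_partitions_def)
  have rho: "int (f (w i)) \<le> \<rho> (w i)" if "i < p" for i
    using f w_image that by (auto simp: P_partitions_def)
  \<comment> \<open>Each descent costs at least 1, so \<open>f (w i) - d i\<close> is still weakly increasing.\<close>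
  have shifted: "int (f (w i)) - int (d i) \<le> int (f (w j)) - int (d j)" if "i \<le> j" "j < p" for i j
    using that
  proof (induction j rule: dec_induct)
    case (step j)
    then show ?case using less[of j] le[of j "Suc j"] by (auto simp: descents_Suc of_bool_def)
  qed simp
  have "int (f (w i)) \<le> rho_bar L \<rho> (w i)" if i: "i < p" for i
  proof -
    obtain j where j: "i \<le> j" "j < p" "rho_bar L \<rho> (w i) = \<rho> (w j) - int (d j) + int (d i)"
      using rho_bar_attained[OF i] .
    then show ?thesis using shifted[of i j] rho[of j] by simp
  qed
  moreover have "f (w i) < f (w j)" if ij: "d i < d j" "i < p" "j < p" for i j
  proof -
    obtain t where t: "i \<le> t" "t < j" "w (Suc t) < w t" using descent_between[OF ij(1)] .
    then have "f (w i) \<le> f (w t)" "f (w t) < f (w (Suc t))" "f (w (Suc t)) \<le> f (w j)"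
      using le less ij by auto
    then show ?thesis by linarith
  qed
  ultimately show ?R using f le by (auto simp: P_partitions_def mono_on_def)
next
  assume R: ?R
  have "int (f x) \<le> \<rho> x" if x: "x \<in> {1..p}" for x
  proof -
    obtain i where i: "i < p" "x = w i" using x unfolding w_image[symmetric] by blast
    then have "int (f (w i)) \<le> rho_bar L \<rho> (w i)" using R by blast
    then show ?thesis using rho_bar_le[of i i \<rho>] i by simp
  qed
  moreover have "f x \<le> f y" if less: "strict_less L x y" for x y
  proof -
    obtain i j where ij: "x = w i" "y = w j" "i < j" "j < p" using less by (rule strict_lessE)
    have "mono_on {..<p} (f \<circ> w)" using R by blast
    from mono_onD[OF this, of i j] show ?thesis using ij by simp
  qed
  moreover have "f x < f y" if less: "strict_less L x y" "y < x" for x y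
  proof -
    obtain i j where ij: "x = w i" "y = w j" "i < j" "j < p" using less(1) by (rule strict_lessE)
    then have "d i < d j" using less_imp_descent less(2) by blast
    then show ?thesis using R ij order_less_trans by blast
  qed
  ultimately show "f \<in> P_partitions p L \<rho>" using R by (auto simp: P_partitions_def)
qed

lemma kept_edges_iff: "(x, y) \<in> kept_edges L \<longleftrightarrow> (\<exists>i. Suc i < p \<and> x = w i \<and> y = w (Suc i) \<and> d (Suc i) = d i)"
  unfolding kept_edges_def using covers_iff by (auto simp: descents_Suc)

definition run :: "nat \<Rightarrow> nat set" where
  "run i = w ` {j. j < p \<and> d j = d i}"

lemma component_eq_run:
  assumes "i < p"
  shows "(kept_edges L \<union> (kept_edges L)\<inverse>)\<^sup>* `` {w i} = run i" (is "?K\<^sup>* `` _ = _")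
proof (intro equalityI subsetI)
  fix y assume "y \<in> ?K\<^sup>* `` {w i}"
  then have "(w i, y) \<in> ?K\<^sup>*" by simp
  then show "y \<in> run i"
  proof (induction rule: rtrancl_induct)
    case base
    then show ?case using assms by (auto simp: run_def)
  next
    case (step y z)
    then obtain j where j: "j < p" "d j = d i" "y = w j" by (auto simp: run_def)
    from step.hyps(2) consider "(y, z) \<in> kept_edges L" | "(z, y) \<in> kept_edges L" by blast
    then show ?case
    proof cases
      case 1
      then obtain k where k: "Suc k < p" "y = w k" "z = w (Suc k)" "d (Suc k) = d k"
        unfolding kept_edges_iff by blast
      then have "k = j" using w_eq_iff[of k j] j(1,3) Suc_lessD by blast
      then show ?thesis using k j by (auto simp: run_def)
    next
      case 2
      then obtain k where k: "Suc k < p" "z = w k" "y = w (Suc k)" "d (Suc k) = d k"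
        unfolding kept_edges_iff by blast
      then have "Suc k = j" using w_eq_iff[of "Suc k" j] j(1,3) by blast
      then show ?thesis using k j by (auto simp: run_def)
    qed
  qed
next
  have conn: "(w i, w j) \<in> ?K\<^sup>*" if "i \<le> j" "j < p" "d i = d j" for i j
    using that
  proof (induction j rule: dec_induct)
    case (step j)
    have "d i \<le> d j" "d j \<le> d (Suc j)" using step.hyps by (simp_all add: descents_mono)
    then have "d i = d j" "d (Suc j) = d j" using step.prems by simp_all
    then have "(w i, w j) \<in> ?K\<^sup>*" using step.IH step.prems(1) by simp
    moreover have "(w j, w (Suc j)) \<in> kept_edges L"
      unfolding kept_edges_iff using \<open>d (Suc j) = d j\<close> step.prems(1) by blast
    then have "(w j, w (Suc j)) \<in> ?K" by (rule UnI1)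
    ultimately show ?case by (rule rtrancl_into_rtrancl)
  qed simp
  have "sym (?K\<^sup>*)" by (intro sym_rtrancl sym_Un_converse)
  fix y assume "y \<in> run i"
  then obtain j where j: "j < p" "d j = d i" "y = w j" by (auto simp: run_def)
  show "y \<in> ?K\<^sup>* `` {w i}"
  proof (cases "i \<le> j")
    case True
    then show ?thesis using conn[of i j] j by simp
  next
    case False
    then have "(w j, w i) \<in> ?K\<^sup>*" using conn[of j i] j assms by simp
    then show ?thesis using \<open>sym (?K\<^sup>*)\<close> j(3) by (auto dest: symD)
  qed
qed

lemma red_chains_eq: "red_chains p L = run ` {..<p}"
proof -
  have "red_chains p L = (\<lambda>x. (kept_edges L \<union> (kept_edges L)\<inverse>)\<^sup>* `` {x}) ` w ` {..<p}"
    unfolding w_image by (auto simp: red_chains_def quotient_def)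
  then show ?thesis using component_eq_run by (simp add: image_image)
qed

end

text \<open>
  In general \<open>rho_bar\<close> may increase along a run, and then \<open>red\<close>, which records only its value at
  the start of each run, does not determine the bounds on the partitions. The following
  condition excludes this, and the orders of standard tableaux with a sorted flag satisfy it.
\<close>

locale run_decreasing = permutation_word +
  fixes \<rho> :: "nat \<Rightarrow> int"
  assumes rho_run: "\<And>i. Suc i < p \<Longrightarrow> w i < w (Suc i) \<Longrightarrow> \<rho> (w (Suc i)) \<le> \<rho> (w i)"
begin

definition bound :: "nat \<Rightarrow> int" where "bound i = rho_bar L \<rho> (w i)"

text \<open>
  The minimum defining the bound at \<open>i\<close> has candidates that the one at \<open>j\<close> lacks only at
  positions between \<open>i\<close> and \<open>j\<close>. On a run \<open>\<rho>\<close> weakly decreases, so none of these beats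
  position \<open>j\<close> itself.
\<close>

lemma bound_run_le:
  assumes "i \<le> j" "j < p" "d i = d j"
  shows "bound i = bound j"
proof (rule antisym)
  show "bound i \<le> bound j" using rho_bar_shifted_mono[of i j \<rho>] assms by (simp add: bound_def)
  obtain k where k: "i \<le> k" "k < p" "bound i = \<rho> (w k) - int (d k) + int (d i)"
    using rho_bar_attained[of i \<rho>] assms unfolding bound_def by auto
  show "bound j \<le> bound i"
  proof (cases "j \<le> k")
    case True
    then show ?thesis using rho_bar_le[of j k \<rho>] k assms by (simp add: bound_def)
  next
    case False
    then have dk: "d k = d j" "d k = d i"
      using descents_mono[of i k w] descents_mono[of k j w] k assms by simp_all
    have "- \<rho> (w k) \<le> - \<rho> (w j)"
    proof (rule ascending_run[of k j w])
      fix t assume t: "k \<le> t" "t < j" "w t \<le> w (Suc t)"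
      have "w t \<noteq> w (Suc t)" using w_eq_iff[of t "Suc t"] t(2) assms(2) by simp
      then have "w t < w (Suc t)" using t(3) by (rule le_neq_trans[rotated])
      then show "- \<rho> (w t) \<le> - \<rho> (w (Suc t))" using rho_run[of t] t assms(2) by simp
    qed (use False dk in auto)
    then show ?thesis using rho_bar_le[of j j \<rho>] assms k dk by (simp add: bound_def)
  qed
qed

lemma bound_run: "i < p \<Longrightarrow> j < p \<Longrightarrow> d i = d j \<Longrightarrow> bound i = bound j"
  using bound_run_le[of i j] bound_run_le[of j i] by (metis nat_le_linear)

lemma bound_less_iff:
  assumes "i < p" "j < p"
  shows "bound i < bound j \<longleftrightarrow> d i < d j"
proof -
  have *: "bound i < bound j" if "d i < d j" "j < p" for i j
  proof -
    have "i \<le> j" using that descents_mono[of j i w] by (meson leD linear)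
    then show ?thesis using rho_bar_shifted_mono[of i j \<rho>] that by (simp add: bound_def)
  qed
  consider "d i < d j" | "d i = d j" | "d j < d i" by linarith
  then show ?thesis
  proof cases
    case 1
    then show ?thesis using *[OF 1 assms(2)] by blast
  next
    case 2
    show ?thesis unfolding bound_run[OF assms 2] unfolding 2 by simp
  next
    case 3
    show ?thesis using *[OF 3 assms(1)] 3 by linarith
  qed
qed

lemma bound_mono: "i \<le> j \<Longrightarrow> j < p \<Longrightarrow> bound i \<le> bound j"
  using rho_bar_shifted_mono[of i j \<rho>] descents_mono[of i j w] by (simp add: bound_def)

lemma chain_pos_run:
  assumes "i < p"
  shows "chain_pos L \<rho> (run i) = bound i"
proof -
  define m where "m = (LEAST j. j < p \<and> d j = d i)"
  have m: "m < p" "d m = d i"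
    using LeastI[of "\<lambda>j. j < p \<and> d j = d i" i] assms by (auto simp: m_def)
  have least: "m \<le> j" if "j < p" "d j = d i" for j
    unfolding m_def using that by (intro Least_le) simp
  have "min_wrt L (run i) = w m"
    unfolding min_wrt_def
  proof (rule the_equality)
    show m_min: "w m \<in> run i \<and> (\<forall>x\<in>run i. (w m, x) \<in> L)"
      using m least by (auto simp: run_def L_iff)
    fix y assume y: "y \<in> run i \<and> (\<forall>x\<in>run i. (y, x) \<in> L)"
    then obtain j where j: "y = w j" "j < p" by (auto simp: run_def)
    then have "j \<le> m" "m \<le> j" using y m_min m L_iff by blast+
    then show "y = w m" using j by simp
  qed
  then show ?thesis using bound_run[OF m(1) assms m(2)] by (simp add: chain_pos_def bound_def)
qed

text \<open>
  The bound is constant on a run, so the runs placed at \<open>k\<close> partition the positions whose bound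
  is \<open>k\<close>.
\<close>

lemma sum_card_runs_at:
  "(\<Sum>C | C \<in> red_chains p L \<and> chain_pos L \<rho> C = k. card C) = card {i. i < p \<and> bound i = k}"
proof -
  let ?R = "{C. C \<in> red_chains p L \<and> chain_pos L \<rho> C = k}"
  have R: "?R = run ` {i. i < p \<and> bound i = k}"
    unfolding red_chains_eq using chain_pos_run by force
  have "pairwise disjnt ?R"
  proof (rule pairwiseI)
    fix C D assume CD: "C \<in> ?R" "D \<in> ?R" "C \<noteq> D"
    then obtain i j where ij: "C = run i" "D = run j" unfolding R by blast
    then have "d i \<noteq> d j" using CD(3) by (auto simp: run_def)
    then show "disjnt C D" using ij w_eq_iff by (auto simp: disjnt_def run_def)
  qed
  then have "(\<Sum>C\<in>?R. card C) = card (\<Union>?R)"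
    by (subst card_Union_disjoint) (auto simp: R run_def)
  also have "\<Union>?R = w ` {i. i < p \<and> bound i = k}"
    unfolding R
  proof (intro equalityI subsetI)
    fix x assume "x \<in> \<Union> (run ` {i. i < p \<and> bound i = k})"
    then obtain i j where "i < p" "bound i = k" "x = w j" "j < p" "d j = d i"
      unfolding run_def by blast
    then show "x \<in> w ` {i. i < p \<and> bound i = k}" using bound_run[of j i] by simp
  next
    fix x assume "x \<in> w ` {i. i < p \<and> bound i = k}"
    then show "x \<in> \<Union> (run ` {i. i < p \<and> bound i = k})" unfolding run_def by blast
  qed
  also have "card \<dots> = card {i. i < p \<and> bound i = k}"
    using w_eq_iff by (intro card_image) (auto simp: inj_on_def)
  finally show ?thesis .
qed

text \<open>
  The length of \<open>red p L \<rho>\<close>.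
\<close>

definition top_pos :: nat where "top_pos = Max (insert 0 ((\<lambda>i. nat (bound i)) ` {..<p}))"

lemma red_eq_content:
  assumes "\<And>i. i < p \<Longrightarrow> 1 \<le> bound i"
  shows "red p L \<rho> = content top_pos p (\<lambda>i. nat (bound i))"
proof -
  have "(\<lambda>C. nat (chain_pos L \<rho> C)) ` red_chains p L = (\<lambda>i. nat (bound i)) ` {..<p}"
    unfolding red_chains_eq image_image using chain_pos_run by simp
  moreover have "{i. i < p \<and> bound i = int k} = {i. i < p \<and> nat (bound i) = k}" for k
    using assms by force
  ultimately show ?thesis
    unfolding red_def content_def sum_card_runs_at top_pos_def by simp
qed

text \<open>
  The bounds jump exactly between runs, so they record where a partition must be strict as well
  as how large it may be.
\<close>

lemma P_partitions_iff_tightens: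
  assumes "\<And>i. i < p \<Longrightarrow> 1 \<le> bound i"
  shows "f \<in> P_partitions p L \<rho> \<longleftrightarrow> f \<in> extensional {1..p} \<and> tightens p (f \<circ> w) (\<lambda>i. nat (bound i))"
proof -
  have "f \<in> {1..p} \<rightarrow>\<^sub>E {1..} \<longleftrightarrow> f \<in> extensional {1..p} \<and> (\<forall>i<p. 1 \<le> f (w i))"
    unfolding PiE_def Pi_def w_image[symmetric] by auto
  moreover have "nat (bound i) < nat (bound j) \<longleftrightarrow> d i < d j" if "i < p" "j < p" for i j
    using assms[OF that(1)] assms[OF that(2)] bound_less_iff[OF that] by simp
  moreover have "int (f (w i)) \<le> rho_bar L \<rho> (w i) \<longleftrightarrow> f (w i) \<le> nat (bound i)" if "i < p" for i
    using assms[OF that] by (auto simp: bound_def)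
  ultimately show ?thesis unfolding P_partitions_iff tightens_def by auto
qed

text \<open>
  The bijection sends \<open>f\<close> to the content of \<open>f \<circ> w\<close>, which is the exponent vector of the
  monomial of \<open>f\<close>.
\<close>

lemma P_partition_gf_eq_slide:
  assumes pos: "\<And>i. i < p \<Longrightarrow> 1 \<le> bound i"
  shows "P_partition_gf p L \<rho> = slide (red p L \<rho>)"
proof -
  define n where "n = top_pos"
  define h where "h i = nat (bound i)" for i
  define a where "a = content n p h"
  define B where "B = {b. length b = length a \<and> dominates b a \<and> refines (flat b) (flat a)}"
  define pos where "pos = inv_into {..<p} w"
  have w_pos: "pos x < p" "w (pos x) = x" if "x \<in> {1..p}" for x
    using that inv_into_into[of x w "{..<p}"] f_inv_into_f[of x w "{..<p}"] w_image by (auto simp: pos_def)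
  have pos_w: "pos (w i) = i" if "i < p" for i
    using that bij by (auto simp: pos_def bij_betw_def)
  have h1: "1 \<le> h i \<and> h i \<le> n" if "i < p" for i
    using assms[OF that] that by (auto simp: h_def n_def top_pos_def intro!: Max_ge)
  have hmono: "mono_on {..<p} h"
    using bound_mono by (auto simp: h_def intro!: mono_onI nat_mono)
  have PP: "f \<in> P_partitions p L \<rho> \<longleftrightarrow> f \<in> extensional {1..p} \<and> tightens p (f \<circ> w) h" for f
    unfolding h_def[abs_def] by (rule P_partitions_iff_tightens[OF assms])
  have range: "mono_on {..<p} g \<and> (\<forall>i<p. 1 \<le> g i \<and> g i \<le> n)" if "tightens p g h" for g
    using that h1 unfolding tightens_def by (meson order_trans)
  have len: "length a = n" and suma: "sum_list a = p"
    using sum_list_content[of p h n] h1 by (simp_all add: a_def)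
  have B_word: "sum_list b = p \<and> length b = n \<and> tightens p (word_of b) h" if "b \<in> B" for b
  proof -
    have b: "length b = n" "sum_list b = p" "dominates b a" "refines (flat b) (flat a)"
      using that len suma by (auto simp: B_def refines_flat_iff)
    have "content n p (word_of b) = b" using content_word_of[of b] b by simp
    then show ?thesis
      using slide_index_iff_tightens[of p "word_of b" n h] mono_word_of[of b] word_of_ge_1[of _ b]
        word_of_le_length[of _ b] hmono h1 b by (simp add: a_def)
  qed
  have a_red: "a = red p L \<rho>"
    unfolding a_def n_def h_def[abs_def] by (rule red_eq_content[OF assms, symmetric])
  have "P_partition_gf p L \<rho> = (\<Sum>f\<in>P_partitions p L \<rho>. \<Prod>x=1..p. X (f x))"
    by (simp add: P_partition_gf_def)
  also have "\<dots> = (\<Sum>b\<in>B. \<Prod>k=1..length a. X k ^ (b ! (k - 1)))"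
  proof (rule sum.reindex_bij_witness[where j = "\<lambda>f. content n p (f \<circ> w)" and
        i = "\<lambda>b. restrict (word_of b \<circ> pos) {1..p}"])
    fix f assume f: "f \<in> P_partitions p L \<rho>"
    then have t: "tightens p (f \<circ> w) h" and ext: "f \<in> extensional {1..p}" by (simp_all add: PP)
    show "content n p (f \<circ> w) \<in> B"
      using slide_index_iff_tightens[of p "f \<circ> w" n h] range[OF t] hmono h1 t len
      by (simp add: B_def a_def)
    show "restrict (word_of (content n p (f \<circ> w)) \<circ> pos) {1..p} = f"
    proof (rule extensionalityI[of _ "{1..p}"])
      fix x assume "x \<in> {1..p}"
      then show "restrict (word_of (content n p (f \<circ> w)) \<circ> pos) {1..p} x = f x"
        using word_of_content[of p "f \<circ> w" n "pos x"] range[OF t] w_pos by simp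
    qed (use ext in auto)
    have "(\<Prod>x=1..p. X (f x)) = (\<Prod>i<p. X (f (w i)))"
      using prod.reindex_bij_betw[OF bij, of "\<lambda>x. X (f x)"] by simp
    also have "\<dots> = (\<Prod>k\<in>{1..n}. \<Prod>i\<in>{i \<in> {..<p}. f (w i) = k}. X (f (w i)))"
      using range[OF t] by (intro prod.group[symmetric]) auto
    also have "\<dots> = (\<Prod>k\<in>{1..n}. X k ^ (content n p (f \<circ> w) ! (k - 1)))"
    proof (rule prod.cong[OF refl])
      fix k assume "k \<in> {1..n}"
      then have "content n p (f \<circ> w) ! (k - 1) = card {i \<in> {..<p}. f (w i) = k}"
        by (auto simp: nth_content intro: arg_cong[where f = card])
      then show "(\<Prod>i\<in>{i \<in> {..<p}. f (w i) = k}. X (f (w i))) = X k ^ (content n p (f \<circ> w) ! (k - 1))"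
        by simp
    qed
    finally show "(\<Prod>k=1..length a. X k ^ (content n p (f \<circ> w) ! (k - 1))) = (\<Prod>x=1..p. X (f x))"
      by (simp add: len)
  next
    fix b assume b: "b \<in> B"
    let ?f = "restrict (word_of b \<circ> pos) {1..p}"
    have eq: "(?f \<circ> w) i = word_of b i" if "i < p" for i
    proof -
      have "w i \<in> {1..p}" using that w_image by blast
      then show ?thesis using pos_w that by simp
    qed
    have "tightens p (?f \<circ> w) h"
      using B_word[OF b] eq unfolding tightens_def mono_on_def by simp
    then show "?f \<in> P_partitions p L \<rho>" by (simp add: PP)
    have "content n p (?f \<circ> w) = content n p (word_of b)"
      unfolding content_def by (simp only: eq cong: conj_cong)
    then show "content n p (?f \<circ> w) = b" using content_word_of[of b] B_word[OF b] by simp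
  qed
  also have "\<dots> = slide (red p L \<rho>)"
    unfolding slide_def B_def a_red ..
  finally show ?thesis .
qed

lemma P_partition_gf_eq:
  "P_partition_gf p L \<rho> = (if \<exists>x\<in>{1..p}. rho_bar L \<rho> x \<le> 0 then 0 else slide (red p L \<rho>))"
proof (cases "\<exists>x\<in>{1..p}. rho_bar L \<rho> x \<le> 0")
  case True
  then obtain i where i: "i < p" "rho_bar L \<rho> (w i) \<le> 0" unfolding w_image[symmetric] by auto
  have "f \<notin> P_partitions p L \<rho>" for f
  proof
    assume f: "f \<in> P_partitions p L \<rho>"
    then have "int (f (w i)) \<le> 0" using i by (force simp: P_partitions_iff)
    moreover have "w i \<in> {1..p}" using i w_image by blast
    then have "1 \<le> f (w i)" using f by (auto simp: P_partitions_def PiE_def Pi_def)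
    ultimately show False by simp
  qed
  then have "P_partitions p L \<rho> = {}" by blast
  then show ?thesis using True by (simp add: P_partition_gf_def)
next
  case False
  have "1 \<le> bound i" if "i < p" for i
  proof -
    have "w i \<in> {1..p}" using that w_image by blast
    then show ?thesis using False by (force simp: bound_def)
  qed
  from P_partition_gf_eq_slide[OF this] show ?thesis using False by simp
qed

end


section \<open>Ranks\<close>

text \<open>
  Standardization ranks cells by a key in an arbitrary linear order; it will be used with
  pairs ordered lexicographically.
\<close>

definition rank :: "'a set \<Rightarrow> ('a \<Rightarrow> 'b :: linorder) \<Rightarrow> 'a \<Rightarrow> nat" where
  "rank A key u = card {v \<in> A. key v \<le> key u}"

lemma rank_le_iff:
  assumes "finite A" "u \<in> A" "v \<in> A"
  shows "rank A key u \<le> rank A key v \<longleftrightarrow> key u \<le> key v"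
proof
  assume "key u \<le> key v"
  then have "{x \<in> A. key x \<le> key u} \<subseteq> {x \<in> A. key x \<le> key v}" by (auto intro: order_trans)
  then show "rank A key u \<le> rank A key v" unfolding rank_def using assms(1) by (intro card_mono) auto
next
  assume le: "rank A key u \<le> rank A key v"
  show "key u \<le> key v"
  proof (rule ccontr)
    assume "\<not> key u \<le> key v"
    then have "{x \<in> A. key x \<le> key v} \<subset> {x \<in> A. key x \<le> key u}" using assms(2) by fastforce
    then have "rank A key v < rank A key u" unfolding rank_def using assms(1) by (intro psubset_card_mono) auto
    then show False using le by simp
  qed
qed

lemma bij_betw_rank:
  assumes "finite A" "inj_on key A"
  shows "bij_betw (rank A key) A {1..card A}"
proof -
  have inj: "inj_on (rank A key) A"
  proof (rule inj_onI)
    fix u v assume uv: "u \<in> A" "v \<in> A" "rank A key u = rank A key v"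
    then have "key u = key v"
      using rank_le_iff[OF assms(1), of u v key] rank_le_iff[OF assms(1), of v u key] by simp
    then show "u = v" using assms(2) uv by (auto dest: inj_onD)
  qed
  have "rank A key ` A \<subseteq> {1..card A}"
  proof
    fix k assume "k \<in> rank A key ` A"
    then obtain u where u: "u \<in> A" "k = rank A key u" by blast
    have "card {u} \<le> rank A key u" unfolding rank_def using assms(1) u by (intro card_mono) auto
    moreover have "rank A key u \<le> card A" unfolding rank_def using assms(1) by (intro card_mono) auto
    ultimately show "k \<in> {1..card A}" using u by simp
  qed
  then have "rank A key ` A = {1..card A}"
    by (intro card_subset_eq) (simp_all add: card_image[OF inj])
  then show ?thesis using inj by (simp add: bij_betw_def)
qed

text \<open>
  An enumeration that sorts by the key can only be the rank: the elements up to \<open>u\<close> occupy the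
  values from 1 to \<open>T u\<close>.
\<close>

lemma rank_unique:
  assumes T: "bij_betw T A {1..card A}" and "u \<in> A"
    and le: "\<And>v. v \<in> A \<Longrightarrow> T v \<le> T u \<longleftrightarrow> key v \<le> key u"
  shows "rank A key u = T u"
proof -
  have inj: "inj_on T A" and im: "T ` A = {1..card A}" using T by (auto simp: bij_betw_def)
  have Tu: "T u \<in> {1..card A}" using im assms(2) by blast
  have "T ` {v \<in> A. key v \<le> key u} = {1..T u}"
  proof (intro equalityI subsetI)
    fix k assume "k \<in> T ` {v \<in> A. key v \<le> key u}"
    then obtain v where v: "v \<in> A" "k = T v" "T v \<le> T u" using le by blast
    then have "k \<in> {1..card A}" using im by blast
    then show "k \<in> {1..T u}" using v by simp
  next
    fix k assume k: "k \<in> {1..T u}"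
    then have "k \<in> T ` A" unfolding im using Tu by simp
    then obtain v where "v \<in> A" "k = T v" by blast
    then show "k \<in> T ` {v \<in> A. key v \<le> key u}" using k le by simp
  qed
  moreover have "card (T ` {v \<in> A. key v \<le> key u}) = card {v \<in> A. key v \<le> key u}"
    using inj by (intro card_image) (auto simp: inj_on_def)
  ultimately show ?thesis by (simp add: rank_def)
qed


section \<open>Standardization of flagged tableaux\<close>

lemma finite_cells [simp]: "finite (cells lam)"
  using bij_betw_finite[OF bij_betw_label, of lam] by simp

lemma card_cells: "card (cells lam) = sum_list lam"
  using bij_betw_same_card[OF bij_betw_label, of lam] by simp

text \<open>
  All labels of row \<open>r'\<close> are at most the total size of the rows from \<open>r'\<close> downwards, and labels
  of the rows above exceed that size.
\<close>

lemma label_lower_row_less: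
  assumes "(r, c) \<in> cells lam" "(r', c') \<in> cells lam" "r < r'"
  shows "label lam (r', c') < label lam (r, c)"
proof -
  have r': "r' - 1 < length lam" "Suc (r' - 1) = r'" "r \<le> r' - 1" "1 \<le> c" "c' \<le> lam ! (r' - 1)"
    using assms by (auto simp: cells_def)
  have "drop (r' - 1) lam = lam ! (r' - 1) # drop r' lam"
    using Cons_nth_drop_Suc[OF r'(1)] r'(2) by simp
  then have *: "sum_list (drop (r' - 1) lam) = lam ! (r' - 1) + sum_list (drop r' lam)" by simp
  have "drop (r' - 1) lam = drop (r' - 1 - r) (drop r lam)"
    unfolding drop_drop le_add_diff_inverse2[OF r'(3)] ..
  then have "drop r lam = take (r' - 1 - r) (drop r lam) @ drop (r' - 1) lam"
    by (metis append_take_drop_id)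
  then have "sum_list (drop (r' - 1) lam) \<le> sum_list (drop r lam)"
    by (metis le_add2 sum_list_append)
  then show ?thesis using * r' by (simp add: label_def)
qed

lemma label_le_imp_row_ge:
  assumes "u \<in> cells lam" "v \<in> cells lam" "label lam u \<le> label lam v"
  shows "fst v \<le> fst u"
  using label_lower_row_less[of "fst u" "snd u" lam "fst v" "snd v"] assms by (cases "fst v \<le> fst u") auto

text \<open>
  Equal entries are ordered by label. In a semistandard tableau equal entries lie in different
  columns, further to the right in higher rows, so this is the usual reading from left to right.
\<close>

definition std_key :: "nat list \<Rightarrow> (nat \<times> nat \<Rightarrow> nat) \<Rightarrow> nat \<times> nat \<Rightarrow> nat \<times> nat" where
  "std_key lam S u = (S u, label lam u)"

definition standardize :: "nat list \<Rightarrow> (nat \<times> nat \<Rightarrow> nat) \<Rightarrow> nat \<times> nat \<Rightarrow> nat" where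
  "standardize lam S = restrict (rank (cells lam) (std_key lam S)) (cells lam)"

lemma inj_std_key: "inj_on (std_key lam S) (cells lam)"
  by (auto simp: inj_on_def std_key_def label_inj)

lemma standardize_le_iff:
  "u \<in> cells lam \<Longrightarrow> v \<in> cells lam \<Longrightarrow>
    standardize lam S u \<le> standardize lam S v \<longleftrightarrow> std_key lam S u \<le> std_key lam S v"
  by (simp add: standardize_def rank_le_iff)

lemma bij_betw_standardize: "bij_betw (standardize lam S) (cells lam) {1..sum_list lam}"
proof -
  have "bij_betw (rank (cells lam) (std_key lam S)) (cells lam) {1..sum_list lam}"
    using bij_betw_rank[OF finite_cells inj_std_key, of lam S] unfolding card_cells .
  then show ?thesis by (rule bij_betw_cong[THEN iffD1, rotated]) (simp add: standardize_def)
qed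

lemma SYT_eq_iff:
  assumes "T \<in> SYT lam" "u \<in> cells lam" "v \<in> cells lam"
  shows "T u = T v \<longleftrightarrow> u = v"
  using assms by (auto simp: SYT_def bij_betw_def inj_on_def)

text \<open>
  Along a row the label breaks ties in favour of the left cell; down a column there are no
  ties.
\<close>

lemma standardize_SYT:
  assumes S: "S \<in> SSYT lam"
  shows "standardize lam S \<in> SYT lam"
proof -
  have less: "standardize lam S u < standardize lam S v"
    if "u \<in> cells lam" "v \<in> cells lam" "std_key lam S u < std_key lam S v" for u v
    using standardize_le_iff[of v lam u S] that by (simp add: not_le[symmetric])
  have "standardize lam S \<in> cells lam \<rightarrow>\<^sub>E {1..}"
    using bij_betw_standardize[of lam S] by (auto simp: bij_betw_def standardize_def)
  moreover have "standardize lam S (r, c) \<le> standardize lam S (r, c')"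
    if "(r, c) \<in> cells lam" "(r, c') \<in> cells lam" "c < c'" for r c c'
  proof -
    have "S (r, c) \<le> S (r, c')" using S that by (auto simp: SSYT_def)
    then show ?thesis using that by (simp add: standardize_le_iff std_key_def label_def)
  qed
  moreover have "standardize lam S (r, c) < standardize lam S (r', c)"
    if "(r, c) \<in> cells lam" "(r', c) \<in> cells lam" "r < r'" for r r' c
  proof -
    have "S (r, c) < S (r', c)" using S that by (auto simp: SSYT_def)
    then show ?thesis using less that by (simp add: std_key_def)
  qed
  ultimately show ?thesis
    using bij_betw_standardize[of lam S] by (simp add: SYT_def SSYT_def)
qed

lemma tableau_order_iff:
  assumes "u \<in> cells lam" "v \<in> cells lam"
  shows "(label lam u, label lam v) \<in> tableau_order lam T \<longleftrightarrow> T u \<le> T v"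
  unfolding tableau_order_def using assms label_inj by blast

lemma strict_less_tableau_order:
  assumes "T \<in> SYT lam" "u \<in> cells lam" "v \<in> cells lam"
  shows "strict_less (tableau_order lam T) (label lam u) (label lam v) \<longleftrightarrow> T u < T v"
  using assms by (auto simp: strict_less_def tableau_order_iff label_inj SYT_eq_iff le_less)

text \<open>
  The defining conditions of \<open>f\<close>, weak growth along the order and strict growth where the label
  drops, say that going up in \<open>T\<close> strictly increases the pair (value, label). Both sides compare
  cells by a total order, so they agree.
\<close>

lemma P_partition_tableau_key:
  assumes T: "T \<in> SYT lam" and f: "f \<in> P_partitions p (tableau_order lam T) \<rho>"
    and uv: "u \<in> cells lam" "v \<in> cells lam"
  shows "T u \<le> T v \<longleftrightarrow> std_key lam (f \<circ> label lam) u \<le> std_key lam (f \<circ> label lam) v"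
proof -
  have less: "std_key lam (f \<circ> label lam) u < std_key lam (f \<circ> label lam) v"
    if "u \<in> cells lam" "v \<in> cells lam" "T u < T v" for u v
  proof -
    have sl: "strict_less (tableau_order lam T) (label lam u) (label lam v)"
      using strict_less_tableau_order[OF T] that by blast
    have "f (label lam u) \<le> f (label lam v)" using f sl by (auto simp: P_partitions_def)
    moreover have "f (label lam u) < f (label lam v)" if "label lam v < label lam u"
      using f sl that by (auto simp: P_partitions_def)
    moreover have "label lam u \<noteq> label lam v" using that by (auto simp: label_inj)
    ultimately show ?thesis by (auto simp: std_key_def)
  qed
  consider "T u < T v" | "T v < T u" | "u = v" using SYT_eq_iff[OF T uv] by linarith
  then show ?thesis
  proof cases
    case 1
    then show ?thesis using less[OF uv] by (simp add: less_imp_le)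
  next
    case 2
    then show ?thesis using less[OF uv(2,1)] by (simp add: not_le)
  qed simp
qed

text \<open>
  The bijection takes a pair of a standard tableau \<open>T\<close> and a partition \<open>f\<close> of its order to the
  filling \<open>f \<circ> label\<close>; the inverse recovers \<open>T\<close> as the standardization.
\<close>

lemma flagged_schur_eq_sum_P_partition_gf:
  "flagged_schur lam b =
    (\<Sum>T\<in>SYT lam. P_partition_gf (sum_list lam) (tableau_order lam T) (flag_rho lam b))"
proof -
  let ?p = "sum_list lam" and ?c = "cells lam" and ?l = "label lam"
  let ?PP = "\<lambda>T. P_partitions ?p (tableau_order lam T) (flag_rho lam b)"
  define FS where "FS = {S. S \<in> SSYT lam \<and> (\<forall>(r, c)\<in>?c. int (S (r, c)) \<le> b ! (r - 1))}"
  have label_mem: "?l u \<in> {1..?p}" if "u \<in> ?c" for u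
    using that label_image by blast
  have fin_SYT: "finite (SYT lam)"
  proof (rule finite_subset)
    show "SYT lam \<subseteq> ?c \<rightarrow>\<^sub>E {1..?p}" by (auto simp: SYT_def SSYT_def PiE_def bij_betw_def)
    show "finite (?c \<rightarrow>\<^sub>E {1..?p})" by (intro finite_PiE) auto
  qed
  have fin_PP: "finite (?PP T)" for T
  proof (rule finite_subset)
    show "?PP T \<subseteq> PiE {1..?p} (\<lambda>x. {..nat (flag_rho lam b x)})"
    proof
      fix f assume f: "f \<in> ?PP T"
      then have "int (f x) \<le> flag_rho lam b x" if "x \<in> {1..?p}" for x
        using that unfolding P_partitions_def by blast
      then have "f x \<le> nat (flag_rho lam b x)" if "x \<in> {1..?p}" for x
        using that by (metis nat_int nat_mono)
      then show "f \<in> PiE {1..?p} (\<lambda>x. {..nat (flag_rho lam b x)})"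
        using f by (auto simp: P_partitions_def PiE_def)
    qed
    show "finite (PiE {1..?p} (\<lambda>x. {..nat (flag_rho lam b x)}))" by (intro finite_PiE) auto
  qed
  have "(\<Sum>T\<in>SYT lam. P_partition_gf ?p (tableau_order lam T) (flag_rho lam b)) =
      (\<Sum>(T, f)\<in>Sigma (SYT lam) ?PP. \<Prod>x=1..?p. X (f x))"
    unfolding P_partition_gf_def using fin_SYT fin_PP by (intro sum.Sigma) auto
  also have "\<dots> = (\<Sum>S\<in>FS. \<Prod>u\<in>?c. X (S u))"
  proof (rule sum.reindex_bij_witness[where j = "\<lambda>(T, f). restrict (f \<circ> ?l) ?c" and
        i = "\<lambda>S. (standardize lam S, restrict (S \<circ> cell_of lam) {1..?p})"])
    fix Tf assume "Tf \<in> Sigma (SYT lam) ?PP"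
    then obtain T f where Tf: "Tf = (T, f)" and T: "T \<in> SYT lam" and f: "f \<in> ?PP T" by auto
    let ?S = "restrict (f \<circ> ?l) ?c"
    have mono: "f (?l u) \<le> f (?l v)" if "T u < T v" "u \<in> ?c" "v \<in> ?c" for u v
      using f strict_less_tableau_order[OF T that(2,3)] that(1) by (auto simp: P_partitions_def)
    have smono: "f (?l u) < f (?l v)" if "T u < T v" "u \<in> ?c" "v \<in> ?c" "?l v < ?l u" for u v
      using f strict_less_tableau_order[OF T that(2,3)] that(1,4) by (auto simp: P_partitions_def)
    have T': "T (r, c) < T (r, c')" if "(r, c) \<in> ?c" "(r, c') \<in> ?c" "c < c'" for r c c'
    proof -
      have "T (r, c) \<le> T (r, c')" using T that by (auto simp: SYT_def SSYT_def)
      moreover have "T (r, c) \<noteq> T (r, c')" using SYT_eq_iff[OF T that(1,2)] that(3) by simp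
      ultimately show ?thesis by simp
    qed
    have "?S \<in> SSYT lam"
      unfolding SSYT_def
    proof (intro CollectI conjI allI impI)
      show "?S \<in> ?c \<rightarrow>\<^sub>E {1..}"
        using f label_mem by (auto simp: P_partitions_def PiE_def Pi_def)
    next
      fix r c c' assume "(r, c) \<in> ?c \<and> (r, c') \<in> ?c \<and> c < c'"
      then show "?S (r, c) \<le> ?S (r, c')" using T' mono by simp
    next
      fix r r' c assume *: "(r, c) \<in> ?c \<and> (r', c) \<in> ?c \<and> r < r'"
      then have "T (r, c) < T (r', c)" using T by (auto simp: SYT_def SSYT_def)
      then show "?S (r, c) < ?S (r', c)" using * smono label_lower_row_less by simp
    qed
    moreover have "int (?S u) \<le> b ! (fst u - 1)" if "u \<in> ?c" for u
    proof -
      have "int (f (?l u)) \<le> flag_rho lam b (?l u)"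
        using f label_mem[OF that] unfolding P_partitions_def by blast
      then show ?thesis using that by (simp add: flag_rho_def)
    qed
    ultimately show "(case Tf of (T, f) \<Rightarrow> restrict (f \<circ> ?l) ?c) \<in> FS"
      by (auto simp: FS_def Tf)
    have "standardize lam ?S = T"
    proof (rule extensionalityI[of _ ?c])
      show "standardize lam ?S \<in> extensional ?c" by (simp add: standardize_def)
      show "T \<in> extensional ?c" using T by (auto simp: SYT_def SSYT_def PiE_def)
      fix u assume u: "u \<in> ?c"
      have "rank ?c (std_key lam ?S) u = T u"
      proof (rule rank_unique)
        show "bij_betw T ?c {1..card ?c}" using T by (simp add: SYT_def card_cells)
        fix v assume v: "v \<in> ?c"
        show "T v \<le> T u \<longleftrightarrow> std_key lam ?S v \<le> std_key lam ?S u"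
          using P_partition_tableau_key[OF T f v u] u v by (simp add: std_key_def)
      qed (rule u)
      then show "standardize lam ?S u = T u" using u by (simp add: standardize_def)
    qed
    moreover have "restrict (?S \<circ> cell_of lam) {1..?p} = f"
    proof (rule extensionalityI[of _ "{1..?p}"])
      show "f \<in> extensional {1..?p}" using f by (auto simp: P_partitions_def PiE_def)
      fix x assume x: "x \<in> {1..?p}"
      then obtain u where "u \<in> ?c" "x = ?l u" using label_image[of lam] by blast
      then show "restrict (?S \<circ> cell_of lam) {1..?p} x = f x" using x by simp
    qed simp
    ultimately show "(standardize lam (case Tf of (T, f) \<Rightarrow> restrict (f \<circ> ?l) ?c),
        restrict ((case Tf of (T, f) \<Rightarrow> restrict (f \<circ> ?l) ?c) \<circ> cell_of lam) {1..?p}) = Tf"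
      by (simp add: Tf)
    have "(\<Prod>u\<in>?c. X (?S u)) = (\<Prod>u\<in>?c. X (f (?l u)))" by (intro prod.cong) auto
    also have "\<dots> = (\<Prod>x=1..?p. X (f x))" by (rule prod.reindex_bij_betw[OF bij_betw_label])
    finally show "(\<Prod>u\<in>?c. X ((case Tf of (T, f) \<Rightarrow> restrict (f \<circ> ?l) ?c) u)) =
        (case Tf of (T, f) \<Rightarrow> \<Prod>x=1..?p. X (f x))" by (simp add: Tf)
  next
    fix S assume "S \<in> FS"
    then have S: "S \<in> SSYT lam" and flag: "\<And>u. u \<in> ?c \<Longrightarrow> int (S u) \<le> b ! (fst u - 1)"
      by (auto simp: FS_def)
    let ?T = "standardize lam S" and ?f = "restrict (S \<circ> cell_of lam) {1..?p}"
    have T: "?T \<in> SYT lam" using standardize_SYT[OF S] .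
    have f_label: "?f (?l u) = S u" if "u \<in> ?c" for u
      using label_mem[OF that] that by simp
    have key: "std_key lam S u < std_key lam S v \<and> u \<in> ?c \<and> v \<in> ?c \<and> i = ?l u \<and> j = ?l v"
      if "strict_less (tableau_order lam ?T) i j" "u \<in> ?c" "v \<in> ?c" "i = ?l u" "j = ?l v" for i j u v
      using that strict_less_tableau_order[OF T that(2,3)] standardize_le_iff[OF that(3,2), of S]
      by (simp add: not_le[symmetric])
    have cells_ex: "\<exists>u v. u \<in> ?c \<and> v \<in> ?c \<and> i = ?l u \<and> j = ?l v"
      if "strict_less (tableau_order lam ?T) i j" for i j
      using that by (auto simp: strict_less_def tableau_order_def)
    have "?f \<in> ?PP ?T"
      unfolding P_partitions_def
    proof (intro CollectI conjI allI impI ballI)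
      show "?f \<in> {1..?p} \<rightarrow>\<^sub>E {1..}"
      proof (intro restrict_PiE_iff[THEN iffD2] ballI)
        fix x assume "x \<in> {1..?p}"
        then obtain u where "u \<in> ?c" "x = ?l u" using label_image[of lam] by blast
        moreover from this have "S u \<in> {1..}" using S by (auto simp: SSYT_def intro: PiE_mem)
        ultimately show "(S \<circ> cell_of lam) x \<in> {1..}" by simp
      qed
    next
      fix i j assume sl: "strict_less (tableau_order lam ?T) i j"
      then obtain u v where uv: "u \<in> ?c" "v \<in> ?c" "i = ?l u" "j = ?l v" using cells_ex by blast
      then have "std_key lam S u < std_key lam S v" using key[OF sl] by blast
      then have "S u \<le> S v" by (auto simp: std_key_def)
      then show "?f i \<le> ?f j" unfolding uv(3,4) f_label[OF uv(1)] f_label[OF uv(2)] .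
    next
      fix i j assume sl: "strict_less (tableau_order lam ?T) i j \<and> j < i"
      then obtain u v where uv: "u \<in> ?c" "v \<in> ?c" "i = ?l u" "j = ?l v" using cells_ex by blast
      then have "std_key lam S u < std_key lam S v" using key sl by blast
      then have "S u < S v" using sl uv by (auto simp: std_key_def)
      then show "?f i < ?f j" unfolding uv(3,4) f_label[OF uv(1)] f_label[OF uv(2)] .
    next
      fix x assume "x \<in> {1..?p}"
      then obtain u where u: "u \<in> ?c" "x = ?l u" using label_image[of lam] by blast
      then show "int (?f x) \<le> flag_rho lam b x"
        unfolding u(2) f_label[OF u(1)] using flag[OF u(1)] by (simp add: flag_rho_def u(1))
    qed
    then show "(?T, ?f) \<in> Sigma (SYT lam) ?PP" using T by simp
    show "(case (?T, ?f) of (T, f) \<Rightarrow> restrict (f \<circ> ?l) ?c) = S"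
    proof (simp only: prod.case, rule extensionalityI[of _ ?c])
      show "S \<in> extensional ?c" using S by (auto simp: SSYT_def PiE_def)
      fix u assume "u \<in> ?c"
      then show "restrict (?f \<circ> ?l) ?c u = S u" using f_label by simp
    qed simp
  qed
  finally show ?thesis by (simp add: flagged_schur_def FS_def)
qed


section \<open>Tableau words\<close>

text \<open>
  Entries of a tableau start at 1 and positions of a word at 0, hence the \<open>Suc\<close>.
\<close>

definition tableau_word :: "nat list \<Rightarrow> (nat \<times> nat \<Rightarrow> nat) \<Rightarrow> nat \<Rightarrow> nat" where
  "tableau_word lam T i = label lam (inv_into (cells lam) T (Suc i))"

lemma tableau_word_entry:
  assumes "T \<in> SYT lam" "u \<in> cells lam"
  shows "tableau_word lam T (T u - 1) = label lam u"
proof -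
  have "bij_betw T (cells lam) {1..sum_list lam}" using assms by (simp add: SYT_def)
  then have "inj_on T (cells lam)" "1 \<le> T u" using assms(2) by (auto simp: bij_betw_def)
  then show ?thesis using assms(2) by (simp add: tableau_word_def)
qed

lemma entry_range: "T \<in> SYT lam \<Longrightarrow> u \<in> cells lam \<Longrightarrow> T u \<in> {1..sum_list lam}"
  by (auto simp: SYT_def bij_betw_def)

lemma tableau_word_cell:
  assumes "T \<in> SYT lam" "i < sum_list lam"
  obtains u where "u \<in> cells lam" "T u = Suc i" "tableau_word lam T i = label lam u"
proof -
  have "Suc i \<in> T ` cells lam" using assms by (auto simp: SYT_def bij_betw_def)
  then obtain u where u: "u \<in> cells lam" "T u = Suc i" by force
  then show ?thesis using that tableau_word_entry[OF assms(1) u(1)] by simp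
qed

lemma bij_betw_tableau_word:
  assumes "T \<in> SYT lam"
  shows "bij_betw (tableau_word lam T) {..<sum_list lam} {1..sum_list lam}"
proof -
  have "bij_betw (label lam \<circ> inv_into (cells lam) T) {1..sum_list lam} {1..sum_list lam}"
    using assms by (intro bij_betw_trans[OF bij_betw_inv_into bij_betw_label]) (simp add: SYT_def)
  moreover have "bij_betw Suc {..<sum_list lam} {1..sum_list lam}"
    by (rule bij_betw_byWitness[where f' = "\<lambda>k. k - 1"]) auto
  ultimately have "bij_betw (label lam \<circ> inv_into (cells lam) T \<circ> Suc) {..<sum_list lam} {1..sum_list lam}"
    by (rule bij_betw_trans[rotated])
  then show ?thesis by (simp add: comp_def tableau_word_def[abs_def])
qed

lemma tableau_order_eq_word_order:
  assumes T: "T \<in> SYT lam"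
  shows "tableau_order lam T = word_order (sum_list lam) (tableau_word lam T)"
proof (intro equalityI subsetI)
  fix z assume "z \<in> tableau_order lam T"
  then obtain u v where uv: "z = (label lam u, label lam v)" "u \<in> cells lam" "v \<in> cells lam" "T u \<le> T v"
    unfolding tableau_order_def by blast
  have "T u - 1 \<le> T v - 1" "T v - 1 < sum_list lam"
    using uv(4) entry_range[OF T uv(3)] by auto
  then show "z \<in> word_order (sum_list lam) (tableau_word lam T)"
    unfolding word_order_def uv(1) tableau_word_entry[OF T uv(2), symmetric]
      tableau_word_entry[OF T uv(3), symmetric] by blast
next
  fix z assume "z \<in> word_order (sum_list lam) (tableau_word lam T)"
  then obtain i j where ij: "z = (tableau_word lam T i, tableau_word lam T j)" "i \<le> j" "j < sum_list lam"
    unfolding word_order_def by blast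
  obtain u where u: "u \<in> cells lam" "T u = Suc i" "tableau_word lam T i = label lam u"
    using tableau_word_cell[OF T order_le_less_trans[OF ij(2,3)]] .
  obtain v where v: "v \<in> cells lam" "T v = Suc j" "tableau_word lam T j = label lam v"
    using tableau_word_cell[OF T ij(3)] .
  show "z \<in> tableau_order lam T"
    unfolding ij(1) u(3) v(3) tableau_order_iff[OF u(1) v(1)] using u(2) v(2) ij(2) by simp
qed

text \<open>
  An ascent of the labels goes to the same row or to a higher one, where the flag is no
  larger.
\<close>

lemma run_decreasing_tableau_word:
  assumes T: "T \<in> SYT lam" and "length b = length lam" "sorted b"
  shows "run_decreasing (sum_list lam) (tableau_word lam T) (flag_rho lam b)"
proof
  show "bij_betw (tableau_word lam T) {..<sum_list lam} {1..sum_list lam}"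
    using bij_betw_tableau_word[OF T] .
  fix i assume i: "Suc i < sum_list lam" "tableau_word lam T i < tableau_word lam T (Suc i)"
  obtain u where u: "u \<in> cells lam" "tableau_word lam T i = label lam u"
    using tableau_word_cell[OF T Suc_lessD[OF i(1)]] .
  obtain v where v: "v \<in> cells lam" "tableau_word lam T (Suc i) = label lam v"
    using tableau_word_cell[OF T i(1)] by metis
  have "fst v \<le> fst u" using label_le_imp_row_ge[OF u(1) v(1)] i(2) u(2) v(2) by simp
  moreover have "1 \<le> fst u" "fst u \<le> length lam" using u(1) by (auto simp: cells_def)
  ultimately have "b ! (fst v - 1) \<le> b ! (fst u - 1)"
    using assms(2,3) by (intro sorted_nth_mono) auto
  then show "flag_rho lam b (tableau_word lam T (Suc i)) \<le> flag_rho lam b (tableau_word lam T i)"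
    by (simp add: u v flag_rho_def)
qed

theorem theorem4p14:
  fixes lam :: "nat list" and b :: "int list"
  assumes "is_partition lam"
    and "length b = length lam" and "sorted b"
  shows "flagged_schur lam b =
      (\<Sum>T\<in>SYT lam. P_partition_gf (sum_list lam) (tableau_order lam T) (flag_rho lam b)) \<and>
    (\<Sum>T\<in>SYT lam. P_partition_gf (sum_list lam) (tableau_order lam T) (flag_rho lam b)) =
      (\<Sum>T\<in>SYT lam.
        if \<exists>i\<in>{1..sum_list lam}. rho_bar (tableau_order lam T) (flag_rho lam b) i \<le> 0 then 0
        else slide (red (sum_list lam) (tableau_order lam T) (flag_rho lam b)))"
proof
  show "flagged_schur lam b =
      (\<Sum>T\<in>SYT lam. P_partition_gf (sum_list lam) (tableau_order lam T) (flag_rho lam b))"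
    by (rule flagged_schur_eq_sum_P_partition_gf)
  show "(\<Sum>T\<in>SYT lam. P_partition_gf (sum_list lam) (tableau_order lam T) (flag_rho lam b)) =
      (\<Sum>T\<in>SYT lam.
        if \<exists>i\<in>{1..sum_list lam}. rho_bar (tableau_order lam T) (flag_rho lam b) i \<le> 0 then 0
        else slide (red (sum_list lam) (tableau_order lam T) (flag_rho lam b)))"
  proof (rule sum.cong[OF refl])
    fix T assume T: "T \<in> SYT lam"
    interpret run_decreasing "sum_list lam" "tableau_word lam T" "flag_rho lam b"
      using T assms(2,3) by (rule run_decreasing_tableau_word)
    show "P_partition_gf (sum_list lam) (tableau_order lam T) (flag_rho lam b) =
        (if \<exists>i\<in>{1..sum_list lam}. rho_bar (tableau_order lam T) (flag_rho lam b) i \<le> 0 then 0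
         else slide (red (sum_list lam) (tableau_order lam T) (flag_rho lam b)))"
      unfolding tableau_order_eq_word_order[OF T] by (rule P_partition_gf_eq)
  qed
qed

end
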